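(* Let $\check\beta$ and $\check\Omega$ be a regular equivariant pair of estimators with exceptional set $N$, and let $N^*$ and $T$ be the associated set and test statistic. Suppose that there exist $v\in\mathbb{R}^q$, $v\ne0$, and $y\in\mathbb{R}^n\setminus N^*$ with $v'\check\Omega^{-1}(y)v>0$, and that for every $v\in\mathbb{R}^q$, $v\ne0$, $\lambda_{\mathbb{R}^n}(\{y\in\mathbb{R}^n\setminus N^*:v'\check\Omega^{-1}(y)v=0\})=0$. For $0<C<\infty$ let $W(C)=\{y\in\mathbb{R}^n:T(y)\ge C\}$. Suppose further that $$T(y+z)=T(y)\quad\text{for every }y\in\mathbb{R}^n\text{ and every }z\in J(\mathfrak{C}).\qquad(\mathrm{a})$$ Assume $\mathfrak{C}$ is bounded (as a subset of $\mathbb{R}^{n\times n}$). Assume also: (b) for every sequence $\Sigma_m\in\mathfrak{C}$ converging to a singular $\bar\Sigma$ there exist a subsequence $(m_i)_{i\in\mathbb{N}}$ and positive reals $s_{m_i}$ such that $D_{m_i}=\Pi_{\operatorname{span}(\bar\Sigma)^\perp}\Sigma_{m_i}\Pi_{\operatorname{span}(\bar\Sigma)^\perp}/s_{m_i}$ converges to a matrix $D$ which is regular on (i.e. injective when restricted to) $\operatorname{span}(\bar\Sigma)^\perp$. Then the following holds (for every $0<C<\infty$ in items 1–3): 1. $\sup_{\mu_0\in\mathfrak{M}_0}\sup_{0<\sigma^2<\infty}\sup_{\Sigma\in\mathfrak{C}}P_{\mu_0,\sigma^2\Sigma}(W(C))<1$, i.e. the size of $W(C)$ is strictly less than $1$.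 Furthermore, $\inf_{\mu_0\in\mathfrak{M}_0}\inf_{0<\sigma^2<\infty}\inf_{\Sigma\in\mathfrak{C}}P_{\mu_0,\sigma^2\Sigma}(W(C))>0$. 2. Suppose that $\lambda_{\mathbb{R}^n}(\{y\in\mathbb{R}^n\setminus N^*:v'\check\Omega^{-1}(y)v\ge0\})>0$ for every $v\in\mathbb{R}^q$ with $\|v\|=1$. Then $\inf_{\mu_1\in\mathfrak{M}_1}\inf_{0<\sigma^2<\infty}\inf_{\Sigma\in\mathfrak{C}}P_{\mu_1,\sigma^2\Sigma}(W(C))>0$. 3. Suppose that $\check\Omega$ is nonnegative definite $\lambda_{\mathbb{R}^n}$-almost everywhere. Then for every $0<c<\infty$ $$\inf_{\mu_1\in\mathfrak{M}_1,\ 0<\sigma^2<\infty,\ d(\mu_1,\mathfrak{M}_0)/\sigma\ge c}P_{\mu_1,\sigma^2\Sigma_m}(W(C))\to1\quad(m\to\infty)$$ for any sequence $\Sigma_m\in\mathfrak{C}$ with $\Sigma_m\to\bar\Sigma$, $\bar\Sigma$ singular. Furthermore, for every sequence $0<c_m<\infty$ $$\inf_{\mu_1\in\mathfrak{M}_1,\ d(\mu_1,\mathfrak{M}_0)\ge c_m}P_{\mu_1,\sigma_m^2\Sigma_m}(W(C))\to1\quad(m\to\infty)$$ whenever $0<\sigma_m^2<\infty$, $c_m/\sigma_m\to\infty$, and $\Sigma_m\in\mathfrak{C}$ satisfies $\Sigma_m\to\bar\Sigma$ with $\bar\Sigma$ positive definite. (This very last statement holds even without condition (a) and condition (b).) 4.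 For every $0<\delta<1$ there exists $C(\delta)$, $0<C(\delta)<\infty$, such that $\sup_{\mu_0\in\mathfrak{M}_0}\sup_{0<\sigma^2<\infty}\sup_{\Sigma\in\mathfrak{C}}P_{\mu_0,\sigma^2\Sigma}(W(C(\delta)))\le\delta$.
   Context: Framework: $n,k,q$ are integers with $1\le k<n$, $q\ge1$; $X$ is a fixed real $n\times k$ matrix of rank $k$; $R$ is a fixed real $q\times k$ matrix of rank $q$; $r\in\mathbb{R}^q$. $\mathfrak{C}$ (covariance model) is a nonempty set of symmetric positive definite $n\times n$ matrices such that $\sigma^2\in(0,\infty)$ and $\Sigma\in\mathfrak{C}$ are uniquely determined by $\sigma^2\Sigma$. $\mathfrak{M}=\operatorname{span}(X)$, $\mathfrak{M}_0=\{X\beta:\beta\in\mathbb{R}^k,\ R\beta=r\}$, $\mathfrak{M}_1=\mathfrak{M}\setminus\mathfrak{M}_0$. $P_{\mu,\Phi}$ is the Gaussian measure on $\mathbb{R}^n$ with mean $\mu$ and covariance matrix $\Phi$. $\Pi_{\mathcal{L}}$ is the orthogonal projection onto $\mathcal{L}$; $\operatorname{span}$ of a matrix is its column space; $d(x,A)$ is Euclidean distance; $\lambda_{\mathbb{R}^n}$ is Lebesgue measure; $\sigma,\sigma_m$ denote positive square roots. $J(\mathfrak{C})=\bigcup\{\operatorname{span}(\bar\Sigma):\det\bar\Sigma=0,\ \bar\Sigma=\lim_{m\to\infty}\Sigma_m\text{ for a sequence }\Sigma_m\in\mathfrak{C}\}$ (possibly empty). Regular equivariant pair with exceptional set $N$: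 (i) $\check\beta:\mathbb{R}^n\setminus N\to\mathbb{R}^k$ and $\check\Omega:\mathbb{R}^n\setminus N\to\mathbb{R}^{q\times q}$ are well-defined and continuous on the complement of a closed $\lambda_{\mathbb{R}^n}$-null set $N$, and $\check\Omega$ is symmetric there; (ii) $y\in\mathbb{R}^n\setminus N$ implies $\alpha y+X\gamma\in\mathbb{R}^n\setminus N$ for all $\alpha\ne0$, $\gamma\in\mathbb{R}^k$; (iii) $\check\beta(\alpha y+X\gamma)=\alpha\check\beta(y)+\gamma$ and $\check\Omega(\alpha y+X\gamma)=\alpha^2\check\Omega(y)$ for all $y\in\mathbb{R}^n\setminus N$, $\alpha\ne0$, $\gamma\in\mathbb{R}^k$; (iv) $\check\Omega$ is nonsingular $\lambda_{\mathbb{R}^n}$-almost everywhere on $\mathbb{R}^n\setminus N$. $N^*=N\cup\{y\in\mathbb{R}^n\setminus N:\det\check\Omega(y)=0\}$. $T(y)=(R\check\beta(y)-r)'\check\Omega^{-1}(y)(R\check\beta(y)-r)$ for $y\in\mathbb{R}^n\setminus N^*$, and $T(y)=0$ for $y\in N^*$. *)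

theory Defs
  imports "HOL-Analysis.Analysis"
begin

definition nonneg_definite :: "real^'a^'a \<Rightarrow> bool" where
  "nonneg_definite A \<longleftrightarrow> transpose A = A \<and> (\<forall>x. 0 \<le> x \<bullet> (A *v x))"

definition pos_definite :: "real^'a^'a \<Rightarrow> bool" where
  "pos_definite A \<longleftrightarrow> transpose A = A \<and> (\<forall>x. x \<noteq> 0 \<longrightarrow> 0 < x \<bullet> (A *v x))"

definition col_span :: "real^'m^'n \<Rightarrow> (real^'n) set" where
  "col_span A = span (columns A)"

definition orth_proj :: "(real^'n) set \<Rightarrow> real^'n \<Rightarrow> real^'n" where
  "orth_proj L x = (THE p. p \<in> L \<and> x - p \<in> orthogonal_comp L)"

definition orth_proj_matrix :: "(real^'n) set \<Rightarrow> real^'n^'n" where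
  "orth_proj_matrix L = matrix (orth_proj L)"

(* Given by its Lebesgue density, hence meaningful only for positive definite \<Phi>;
   every covariance matrix \<sigma>\<^sup>2 \<Sigma> below is of this kind. *)
definition gaussian :: "real^'n \<Rightarrow> real^'n^'n \<Rightarrow> (real^'n) measure" where
  "gaussian \<mu> \<Phi> = density lborel
     (\<lambda>y. ennreal (exp (- ((y - \<mu>) \<bullet> (matrix_inv \<Phi> *v (y - \<mu>))) / 2)
                   / sqrt ((2 * pi) ^ CARD('n) * det \<Phi>)))"

(* The last clause: \<sigma>\<^sup>2 and \<Sigma> are uniquely determined by the product \<sigma>\<^sup>2 \<Sigma>. *)
definition covariance_model :: "(real^'n^'n) set \<Rightarrow> bool" where
  "covariance_model \<CC> \<longleftrightarrow> \<CC> \<noteq> {} \<and> (\<forall>\<Sigma>\<in>\<CC>. pos_definite \<Sigma>) \<and>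
     (\<forall>s t. \<forall>\<Sigma>\<in>\<CC>. \<forall>\<Sigma>'\<in>\<CC>. 0 < s \<and> 0 < t \<and> s *\<^sub>R \<Sigma> = t *\<^sub>R \<Sigma>'
        \<longrightarrow> s = t \<and> \<Sigma> = \<Sigma>')"

definition null_means :: "real^'k^'n \<Rightarrow> real^'k^'q \<Rightarrow> real^'q \<Rightarrow> (real^'n) set" where
  "null_means X R r = {X *v \<beta> | \<beta>. R *v \<beta> = r}"

definition alt_means :: "real^'k^'n \<Rightarrow> real^'k^'q \<Rightarrow> real^'q \<Rightarrow> (real^'n) set" where
  "alt_means X R r = col_span X - null_means X R r"

definition sing_limit_union :: "(real^'n^'n) set \<Rightarrow> (real^'n) set" where
  "sing_limit_union \<CC> =
     \<Union> {col_span \<Sigma>' | \<Sigma>'. det \<Sigma>' = 0 \<and> (\<exists>S. (\<forall>m. S m \<in> \<CC>) \<and> S \<longlonglongrightarrow> \<Sigma>')}"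

(* The estimators are partial functions on the complement of N, modelled by total functions
   whose values on N are irrelevant. *)
definition regular_equivariant_pair ::
  "real^'k^'n \<Rightarrow> (real^'n) set \<Rightarrow> (real^'n \<Rightarrow> real^'k) \<Rightarrow> (real^'n \<Rightarrow> real^'q^'q) \<Rightarrow> bool" where
  "regular_equivariant_pair X N b \<Omega> \<longleftrightarrow>
     closed N \<and> N \<in> null_sets lborel \<and>
     continuous_on (- N) b \<and> continuous_on (- N) \<Omega> \<and>
     (\<forall>y. y \<notin> N \<longrightarrow> transpose (\<Omega> y) = \<Omega> y) \<and>
     (\<forall>y \<alpha> \<gamma>. y \<notin> N \<and> \<alpha> \<noteq> 0 \<longrightarrow>
        \<alpha> *\<^sub>R y + X *v \<gamma> \<notin> N \<and>
        b (\<alpha> *\<^sub>R y + X *v \<gamma>) = \<alpha> *\<^sub>R b y + \<gamma> \<and>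
        \<Omega> (\<alpha> *\<^sub>R y + X *v \<gamma>) = \<alpha>\<^sup>2 *\<^sub>R \<Omega> y) \<and>
     (AE y in lborel. y \<notin> N \<longrightarrow> invertible (\<Omega> y))"

definition N_star :: "(real^'n) set \<Rightarrow> (real^'n \<Rightarrow> real^'q^'q) \<Rightarrow> (real^'n) set" where
  "N_star N \<Omega> = N \<union> {y. y \<notin> N \<and> det (\<Omega> y) = 0}"

definition test_stat ::
  "real^'k^'q \<Rightarrow> real^'q \<Rightarrow> (real^'n) set \<Rightarrow> (real^'n \<Rightarrow> real^'k) \<Rightarrow> (real^'n \<Rightarrow> real^'q^'q)
     \<Rightarrow> real^'n \<Rightarrow> real" where
  "test_stat R r N b \<Omega> y =
     (if y \<in> N_star N \<Omega> then 0
      else (R *v b y - r) \<bullet> (matrix_inv (\<Omega> y) *v (R *v b y - r)))"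

definition rejection_region ::
  "real^'k^'q \<Rightarrow> real^'q \<Rightarrow> (real^'n) set \<Rightarrow> (real^'n \<Rightarrow> real^'k) \<Rightarrow> (real^'n \<Rightarrow> real^'q^'q)
     \<Rightarrow> real \<Rightarrow> (real^'n) set" where
  "rejection_region R r N b \<Omega> C = {y. test_stat R r N b \<Omega> y \<ge> C}"

end

theory Submission
  imports Defs "HOL-Probability.Distributions"
begin

text \<open>
  Write \<Sigma> = A A' with A invertible and let Z be standard Gaussian. A mean in the model is
  \<mu> = X(\<beta> + \<gamma>) with R\<beta> = r. Equivariance of the estimators turns the rejection
  probability under (\<mu>, \<sigma>^2\<Sigma>) into the probability that G(AZ, w) \<ge> C, where
  G(y, w) = (R b(y) + w)' \<Omega>^-1(y) (R b(y) + w) and w = R\<gamma>/\<sigma>. So all nuisance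
  parameters collapse to the pair (A, w), and \<mu> \<in> M0 means w = 0
  (\<open>rejection_probability\<close>).

  For a convergent sequence of factors with an invertible limit everything is soft: G is continuous
  outside a closed null set and an invertible linear map preserves null sets, hence
  G(A_i Z, w_i) \<longrightarrow> G(A_0 Z, w) almost surely, and Fatou's lemma transfers bounds between the
  sequence and its limit. If the shifts w_i diverge in direction v, then
  G(A_i Z, w_i)/(norm w_i)^2 \<longrightarrow> v' \<Omega>^-1(A_0 Z) v instead, so that rejection becomes certain
  where this limit is positive.

  The difficulty is a sequence \<Sigma>_m with a singular limit, say with column space L. Here the two
  conditions enter. By (a) the function y \<mapsto> G(y, w) is constant along L, so A_m may be changed by
  any matrix with range in L; by equivariance A_m and w may be multiplied by a common
  factor t. Projecting A_m onto L^\<bottom> and rescaling by t_m = 1 / sqrt s_m produces, by (b), a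
  subsequence converging to some B with range L^\<bottom>; adding a fixed matrix that maps the kernel of B
  isomorphically onto L makes the limit invertible (\<open>renormalized_factors\<close>). Since
  t_m \<longrightarrow> \<infinity>, every shift that is bounded away from zero diverges after rescaling. This is why
  the power tends to one in the third item, whereas the zero shift of the null hypothesis is unaffected.

  As the covariance model is bounded, every sequence in it has a subsequence whose limit is positive
  definite or which can be renormalized in this way, and each uniform bound follows by contradiction: a sequence of
  would-be counterexamples contradicts the limit statement. What remains for the limits is that
  suitable events have positive probability, which holds because they are nonempty and open, or by the
  assumptions on v' \<Omega>^-1 v.
\<close>

section \<open>The standard Gaussian measure and its linear images\<close>

lemma matrix_inv_eqI:
  fixes A :: "real^'n^'n"
  assumes "A ** B = mat 1"
  shows "matrix_inv A = B"
proof -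
  have BA: "B ** A = mat 1"
    using assms matrix_left_right_inverse by blast
  have "A ** matrix_inv A = mat 1 \<and> matrix_inv A ** A = mat 1"
    unfolding matrix_inv_def by (rule someI[of _ B]) (simp add: assms BA)
  then show ?thesis
    by (metis BA matrix_mul_assoc matrix_mul_lid matrix_mul_rid)
qed

lemma
  fixes A :: "real^'n^'n"
  assumes "det A \<noteq> 0"
  shows matrix_inv_left: "matrix_inv A ** A = mat 1"
    and matrix_inv_right: "A ** matrix_inv A = mat 1"
  using assms matrix_inv_eqI matrix_left_right_inverse
  by (metis invertible_det_nz invertible_right_inverse)+

lemma borel_measurable_matrix_vector_mult [measurable]:
  "(*v) (A :: real^'m^'n) \<in> borel_measurable borel"
  by (simp add: borel_measurable_continuous_onI matrix_vector_mult_linear_continuous_on)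

text \<open>The density factorizes over the coordinates, which reduces its total mass to the one-dimensional case.\<close>

lemma standard_gaussian_density:
  "gaussian (0::real^'n) (mat 1)
     = density lborel (\<lambda>y. ennreal (\<Prod>b\<in>Basis. std_normal_density (y \<bullet> b)))"
proof -
  have "exp (- (y \<bullet> y) / 2) / sqrt ((2 * pi) ^ CARD('n))
      = (\<Prod>b\<in>Basis. std_normal_density (y \<bullet> b))" for y :: "real^'n"
  proof -
    have "(\<Prod>b\<in>(Basis::(real^'n) set). std_normal_density (y \<bullet> b))
        = 1 / sqrt (2 * pi) ^ CARD('n) * (\<Prod>b\<in>(Basis::(real^'n) set). exp (- ((y \<bullet> b)\<^sup>2 / 2)))"
      by (simp add: std_normal_density_def prod_dividef)
    also have "\<dots> = 1 / sqrt (2 * pi) ^ CARD('n) * exp (- (y \<bullet> y) / 2)"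
      by (simp add: exp_sum[symmetric] euclidean_inner[of y y] power2_eq_square
          sum_negf sum_divide_distrib)
    finally show ?thesis
      unfolding real_sqrt_power by simp
  qed
  moreover have "matrix_inv (mat 1 :: real^'n^'n) = mat 1"
    by (rule matrix_inv_eqI) simp
  ultimately show ?thesis
    by (simp add: gaussian_def)
qed

lemma prob_space_standard_gaussian: "prob_space (gaussian (0::real^'n) (mat 1))"
proof
  have "(\<integral>\<^sup>+y. ennreal (\<Prod>b\<in>Basis. std_normal_density (y \<bullet> b)) \<partial>(lborel :: (real^'n) measure))
      = (\<integral>\<^sup>+y. (\<Prod>b\<in>Basis. ennreal (std_normal_density (y \<bullet> b))) \<partial>(lborel :: (real^'n) measure))"
    by (simp only: prod_ennreal normal_density_nonneg)
  also have "\<dots> = (\<Prod>b\<in>(Basis::(real^'n) set). \<integral>\<^sup>+x. ennreal (std_normal_density x) \<partial>lborel)"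
    by (rule nn_integral_lborel_prod) auto
  also have "\<dots> = 1"
    by (simp add: nn_integral_eq_integral)
  finally show "emeasure (gaussian (0::real^'n) (mat 1)) (space (gaussian 0 (mat 1))) = 1"
    by (simp add: standard_gaussian_density emeasure_density)
qed

lemma sets_gaussian [measurable_cong, simp]: "sets (gaussian \<mu> \<Phi>) = sets borel"
  by (simp add: gaussian_def)

lemma space_gaussian [simp]: "space (gaussian \<mu> \<Phi>) = UNIV"
  by (simp add: gaussian_def)

lemma AE_standard_gaussian_iff:
  "(AE z in gaussian (0::real^'n) (mat 1). Q z) \<longleftrightarrow> (AE z in lborel. Q z)"
  unfolding standard_gaussian_density
  by (subst AE_density) (auto simp: prod_pos normal_density_pos)

text \<open>By Fubini: for fixed values of all coordinates other than e, the number x \<bullet> w is a constant,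
  and the shear is a translation of the coordinate e.\<close>

lemma nn_integral_lborel_shear:
  fixes f :: "'a::euclidean_space \<Rightarrow> ennreal"
  assumes [measurable]: "f \<in> borel_measurable borel" and e: "e \<in> Basis" and we: "w \<bullet> e = 0"
  shows "(\<integral>\<^sup>+x. f (x + (x \<bullet> w) *\<^sub>R e) \<partial>lborel) = (\<integral>\<^sup>+x. f x \<partial>lborel)"
proof -
  interpret product_sigma_finite "\<lambda>_::'a. lborel :: real measure" ..
  let ?B = "Basis - {e}"
  have split: "(\<integral>\<^sup>+x. g x \<partial>(lborel :: 'a measure)) =
     (\<integral>\<^sup>+h. \<integral>\<^sup>+t. g (t *\<^sub>R e + (\<Sum>b\<in>?B. h b *\<^sub>R b)) \<partial>lborel \<partial>(Pi\<^sub>M ?B (\<lambda>_. lborel)))"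
    if [measurable]: "g \<in> borel_measurable borel" for g
  proof -
    have ins: "insert e ?B = (Basis :: 'a set)"
      using e by auto
    have "(\<integral>\<^sup>+x. g x \<partial>(lborel :: 'a measure)) =
       (\<integral>\<^sup>+h. g (\<Sum>b\<in>Basis. h b *\<^sub>R b) \<partial>(Pi\<^sub>M Basis (\<lambda>_. lborel)))"
      by (subst lborel_def) (simp add: nn_integral_distr lborel_eq_real)
    also have "\<dots> = (\<integral>\<^sup>+h. g (\<Sum>b\<in>Basis. h b *\<^sub>R b) \<partial>(Pi\<^sub>M (insert e ?B) (\<lambda>_. lborel)))"
      by (simp only: ins)
    also have "\<dots> = (\<integral>\<^sup>+h. \<integral>\<^sup>+t. g (\<Sum>b\<in>Basis. (h(e := t)) b *\<^sub>R b) \<partial>lborel \<partial>(Pi\<^sub>M ?B (\<lambda>_. lborel)))"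
    proof (rule product_nn_integral_insert)
      show "(\<lambda>h. g (\<Sum>b\<in>Basis. h b *\<^sub>R b)) \<in> borel_measurable (Pi\<^sub>M (insert e ?B) (\<lambda>_. lborel))"
        unfolding ins by measurable
    qed auto
    also have "\<dots> = (\<integral>\<^sup>+h. \<integral>\<^sup>+t. g (t *\<^sub>R e + (\<Sum>b\<in>?B. h b *\<^sub>R b)) \<partial>lborel \<partial>(Pi\<^sub>M ?B (\<lambda>_. lborel)))"
      using e by (simp add: sum.remove[OF finite_Basis e])
    finally show ?thesis .
  qed
  have "(\<integral>\<^sup>+x. f (x + (x \<bullet> w) *\<^sub>R e) \<partial>lborel) =
     (\<integral>\<^sup>+h. \<integral>\<^sup>+t. f ((((\<Sum>b\<in>?B. h b *\<^sub>R b) \<bullet> w) + 1 * t) *\<^sub>R e + (\<Sum>b\<in>?B. h b *\<^sub>R b)) \<partial>lborel \<partial>(Pi\<^sub>M ?B (\<lambda>_. lborel)))"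
    using we by (subst split) (simp_all add: inner_add_left inner_commute[of e] algebra_simps)
  also have "\<dots> = (\<integral>\<^sup>+h. \<integral>\<^sup>+t. f (t *\<^sub>R e + (\<Sum>b\<in>?B. h b *\<^sub>R b)) \<partial>lborel \<partial>(Pi\<^sub>M ?B (\<lambda>_. lborel)))"
  proof (rule nn_integral_cong)
    fix h :: "'a \<Rightarrow> real"
    show "(\<integral>\<^sup>+t. f ((((\<Sum>b\<in>?B. h b *\<^sub>R b) \<bullet> w) + 1 * t) *\<^sub>R e + (\<Sum>b\<in>?B. h b *\<^sub>R b)) \<partial>lborel)
       = (\<integral>\<^sup>+t. f (t *\<^sub>R e + (\<Sum>b\<in>?B. h b *\<^sub>R b)) \<partial>lborel)"
      by (subst nn_integral_real_affine[where c=1 and t="(\<Sum>b\<in>?B. h b *\<^sub>R b) \<bullet> w" and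
            f="\<lambda>t. f (t *\<^sub>R e + (\<Sum>b\<in>?B. h b *\<^sub>R b))"]) simp_all
  qed
  also have "\<dots> = (\<integral>\<^sup>+x. f x \<partial>lborel)"
    by (rule split[symmetric]) simp
  finally show ?thesis .
qed

lemma prod_Basis_cart: "(\<Prod>b\<in>(Basis :: (real^'n) set). g b) = (\<Prod>i\<in>UNIV. g (axis i 1))"
proof -
  have "(Basis :: (real^'n) set) = range (\<lambda>i. axis i 1)"
    by (auto simp: Basis_vec_def)
  moreover have "inj (\<lambda>i::'n. axis i (1::real))"
    by (auto simp: inj_on_def axis_eq_axis)
  ultimately show ?thesis
    by (metis (no_types, lifting) prod.reindex_cong)
qed

text \<open>The change of variables formula, for an arbitrary finite index type (no order on the coordinates).
  Both sides are multiplicative in the matrix, so that elementary matrices suffice.\<close>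

lemma nn_integral_lborel_matrix:
  fixes A :: "real^'n^'n" and f :: "real^'n \<Rightarrow> ennreal"
  assumes "det A \<noteq> 0" and "f \<in> borel_measurable borel"
  shows "(\<integral>\<^sup>+x. f x \<partial>lborel) = ennreal \<bar>det A\<bar> * (\<integral>\<^sup>+x. f (A *v x) \<partial>lborel)"
proof -
  let ?P = "\<lambda>A :: real^'n^'n. det A \<noteq> 0 \<longrightarrow> (\<forall>f \<in> borel_measurable borel.
    (\<integral>\<^sup>+x. f x \<partial>lborel) = ennreal \<bar>det A\<bar> * (\<integral>\<^sup>+x. f (A *v x) \<partial>lborel))"
  have "?P A"
  proof (rule induct_matrix_elementary_alt[of ?P])
    fix A B :: "real^'n^'n"
    assume A: "?P A" and B: "?P B"
    show "?P (A ** B)"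
    proof (intro impI ballI)
      fix f :: "real^'n \<Rightarrow> ennreal"
      assume "det (A ** B) \<noteq> 0" and [measurable]: "f \<in> borel_measurable borel"
      then have nz: "det A \<noteq> 0" "det B \<noteq> 0"
        by (simp_all add: det_mul)
      have "(\<integral>\<^sup>+x. f x \<partial>lborel) = ennreal \<bar>det A\<bar> * (\<integral>\<^sup>+x. f (A *v x) \<partial>lborel)"
        by (rule A[rule_format, OF nz(1)]) measurable
      also have "(\<integral>\<^sup>+x. f (A *v x) \<partial>lborel) = ennreal \<bar>det B\<bar> * (\<integral>\<^sup>+x. f (A *v (B *v x)) \<partial>lborel)"
        by (rule B[rule_format, OF nz(2)]) measurable
      finally show "(\<integral>\<^sup>+x. f x \<partial>lborel) = ennreal \<bar>det (A ** B)\<bar> * (\<integral>\<^sup>+x. f ((A ** B) *v x) \<partial>lborel)"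
        by (simp add: det_mul abs_mult ennreal_mult' matrix_vector_mul_assoc flip: mult.assoc)
    qed
  next
    fix A :: "real^'n^'n" and i assume "row i A = 0"
    then show "?P A"
      by (simp add: det_zero_row(2))
  next
    fix A :: "real^'n^'n" assume diag: "\<And>i j. i \<noteq> j \<Longrightarrow> A $ i $ j = 0"
    show "?P A"
    proof (intro impI ballI)
      fix f :: "real^'n \<Rightarrow> ennreal"
      assume nz: "det A \<noteq> 0" and [measurable]: "f \<in> borel_measurable borel"
      have det: "det A = (\<Prod>i\<in>UNIV. A $ i $ i)"
        using diag by (rule det_diagonal)
      define c where "c b = b \<bullet> (A *v b)" for b :: "real^'n"
      have c: "c (axis i 1) = A $ i $ i" for i
        by (simp add: c_def inner_axis' matrix_vector_mul_component inner_axis)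
      have c_nz: "c b \<noteq> 0" if "b \<in> Basis" for b
        using that nz det by (auto simp: Basis_vec_def c)
      have "(0 + (\<Sum>j\<in>Basis. (c j * (x \<bullet> j)) *\<^sub>R j)) \<bullet> b = (A *v x) \<bullet> b" if "b \<in> Basis" for x b
      proof -
        obtain i where b: "b = axis i 1"
          using \<open>b \<in> Basis\<close> by (auto simp: Basis_vec_def)
        have "(\<Sum>j\<in>UNIV. A $ i $ j * x $ j) = A $ i $ i * x $ i"
          using diag by (subst sum.remove[of _ i]) auto
        moreover have "(0 + (\<Sum>j\<in>Basis. (c j * (x \<bullet> j)) *\<^sub>R j)) \<bullet> b = c b * (x \<bullet> b)"
          using \<open>b \<in> Basis\<close> by (simp add: inner_sum_left_Basis)
        ultimately show ?thesis
          by (simp add: b c inner_axis matrix_vector_mult_def)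
      qed
      then have map: "(0 + (\<Sum>j\<in>Basis. (c j * (x \<bullet> j)) *\<^sub>R j)) = A *v x" for x
        by (rule euclidean_eqI)
      have "(\<Prod>j\<in>Basis. \<bar>c j\<bar>) = \<bar>det A\<bar>"
        by (simp add: prod_Basis_cart c det abs_prod)
      then have "lborel = density (distr lborel borel ((*v) A)) (\<lambda>_. ennreal \<bar>det A\<bar>)"
        using lborel_affine_euclidean[of c 0] c_nz map by auto
      then have "(\<integral>\<^sup>+x. f x \<partial>lborel)
          = (\<integral>\<^sup>+x. f x \<partial>density (distr lborel borel ((*v) A)) (\<lambda>_. ennreal \<bar>det A\<bar>))"
        by metis
      then show "(\<integral>\<^sup>+x. f x \<partial>lborel) = ennreal \<bar>det A\<bar> * (\<integral>\<^sup>+x. f (A *v x) \<partial>lborel)"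
        by (simp add: nn_integral_density nn_integral_distr nn_integral_cmult)
    qed
  next
    fix m n :: 'n assume "m \<noteq> n"
    let ?p = "Transposition.transpose m n"
    let ?A = "(\<chi> i j. mat 1 $ i $ ?p j) :: real^'n^'n"
    let ?h = "\<lambda>x :: real^'n. \<chi> i. x $ ?p i"
    have entry: "(mat 1 $ i $ ?p j :: real) = (if j = ?p i then 1 else 0)" for i j
      by (auto simp: mat_def)
    have Ax: "?A *v x = ?h x" for x
      by (simp add: vec_eq_iff matrix_vector_mult_def entry if_distrib[of "\<lambda>x. x * _"] cong: if_cong)
    have det: "\<bar>det ?A\<bar> = 1"
      by (simp add: det_permute_columns permutes_swap_id sign_swap_id)
    have [measurable]: "?h \<in> borel_measurable borel"
      using borel_measurable_matrix_vector_mult[of ?A] Ax by (metis (no_types, lifting) ext)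
    have "lborel = distr lborel borel ?h"
    proof (rule lborel_eqI)
      fix l u :: "real^'n" assume lu: "\<And>b. b \<in> Basis \<Longrightarrow> l \<bullet> b \<le> u \<bullet> b"
      have le: "l $ i \<le> u $ i" for i
        using lu[of "axis i 1"] by (simp add: inner_axis)
      have hle: "?h l \<bullet> b \<le> ?h u \<bullet> b" if "b \<in> Basis" for b
        using that le by (auto simp: Basis_vec_def inner_axis)
      have "?h -` box l u = box (?h l) (?h u)"
        by (auto simp: mem_box_cart) (metis transpose_involutory)+
      then have "emeasure (distr lborel borel ?h) (box l u) = (\<Prod>i\<in>UNIV. (u - l) $ ?p i)"
        using emeasure_lborel_box[of "?h l" "?h u"] le
        by (simp add: emeasure_distr prod_Basis_cart inner_axis hle)
      also have "(\<Prod>i\<in>UNIV. (u - l) $ ?p i) = (\<Prod>i\<in>UNIV. (u - l) $ i)"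
        by (rule prod.permute[OF permutes_swap_id, symmetric, unfolded o_def]) auto
      finally show "emeasure (distr lborel borel ?h) (box l u) = (\<Prod>b\<in>Basis. (u - l) \<bullet> b)"
        by (simp add: prod_Basis_cart inner_axis)
    qed simp
    then have *: "(\<integral>\<^sup>+x. f x \<partial>lborel) = (\<integral>\<^sup>+x. f x \<partial>distr lborel borel ?h)" for f :: "real^'n \<Rightarrow> ennreal"
      by metis
    show "?P ?A"
      unfolding det Ax by (subst *) (simp add: nn_integral_distr)
  next
    fix m n :: 'n assume "m \<noteq> n"
    let ?A = "(\<chi> i j. of_bool (i = m \<and> j = n \<or> i = j)) :: real^'n^'n"
    have "?A *v x = x + (x $ n) *\<^sub>R axis m 1" for x
      using \<open>m \<noteq> n\<close>
      by (auto simp: vec_eq_iff matrix_vector_mult_def axis_def of_bool_def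
          if_distrib[of "\<lambda>x. x * _"] sum.remove[of UNIV n] cong: if_cong)
    then have Ax: "?A *v x = x + (x \<bullet> axis n 1) *\<^sub>R axis m 1" for x
      by (simp add: inner_axis)
    have row_op: "?A = (\<chi> k. if k = m then row m (mat 1) + 1 *s row n (mat 1) else row k (mat 1))"
      using \<open>m \<noteq> n\<close> by (auto simp: vec_eq_iff row_def mat_def)
    have det: "det ?A = 1"
      unfolding row_op det_row_operation[OF \<open>m \<noteq> n\<close>] by simp
    show "?P ?A"
    proof (intro impI ballI)
      fix f :: "real^'n \<Rightarrow> ennreal" assume "f \<in> borel_measurable borel"
      then have "(\<integral>\<^sup>+x. f (?A *v x) \<partial>lborel) = (\<integral>\<^sup>+x. f x \<partial>lborel)"
        unfolding Ax using \<open>m \<noteq> n\<close> by (intro nn_integral_lborel_shear) (auto simp: inner_axis_axis)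
      then show "(\<integral>\<^sup>+x. f x \<partial>lborel) = ennreal \<bar>det ?A\<bar> * (\<integral>\<^sup>+x. f (?A *v x) \<partial>lborel)"
        unfolding det by simp
    qed
  qed
  then show ?thesis
    using assms by blast
qed

lemma AE_lborel_matrix_iff:
  fixes A :: "real^'n^'n"
  assumes "det A \<noteq> 0" and [measurable]: "Measurable.pred borel Q"
  shows "(AE z in lborel. Q (A *v z)) \<longleftrightarrow> (AE y in lborel. Q y)"
proof -
  have "emeasure lborel {y. \<not> Q y} = ennreal \<bar>det A\<bar> * emeasure lborel {z. \<not> Q (A *v z)}"
    using nn_integral_lborel_matrix[OF assms(1), of "indicator {y. \<not> Q y}"]
    by (simp add: indicator_def flip: nn_integral_indicator)
  then show ?thesis
    using assms(1) by (simp add: AE_iff_measurable[OF _ refl])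
qed

text \<open>The bridge from densities to random vectors: a Gaussian vector is an affine image of a standard one.\<close>

lemma gaussian_eq_distr:
  fixes B :: "real^'n^'n"
  assumes "det B \<noteq> 0"
  shows "gaussian \<mu> (B ** transpose B) = distr (gaussian 0 (mat 1)) borel (\<lambda>z. \<mu> + B *v z)"
proof (rule measure_eqI)
  have inv: "B ** matrix_inv B = mat 1" "matrix_inv B ** B = mat 1"
    using assms by (simp_all add: matrix_inv_left matrix_inv_right)
  define f where "f \<equiv> \<lambda>(\<Phi> :: real^'n^'n) (y :: real^'n).
    ennreal (exp (- (y \<bullet> (matrix_inv \<Phi> *v y)) / 2) / sqrt ((2 * pi) ^ CARD('n) * det \<Phi>))"
  have f_meas [measurable]: "f \<Phi> \<in> borel_measurable borel" for \<Phi>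
    unfolding f_def by measurable
  have gf: "gaussian \<mu> \<Phi> = density lborel (\<lambda>y. f \<Phi> (y - \<mu>))" for \<mu> \<Phi>
    by (simp add: gaussian_def f_def)
  define V where "V = matrix_inv B"
  have V: "B ** V = mat 1" "V ** B = mat 1"
    using inv by (simp_all add: V_def)
  have minv: "matrix_inv (B ** transpose B) = transpose V ** V"
  proof (rule matrix_inv_eqI)
    have "B ** transpose B ** (transpose V ** V) = B ** transpose (V ** B) ** V"
      by (simp add: matrix_transpose_mul matrix_mul_assoc)
    then show "B ** transpose B ** (transpose V ** V) = mat 1"
      by (simp add: V)
  qed
  have quad: "(B *v z) \<bullet> (matrix_inv (B ** transpose B) *v (B *v z)) = z \<bullet> z" for z
  proof -
    have "V *v (B *v z) = z"
      by (simp add: matrix_vector_mul_assoc V)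
    then show ?thesis
      by (simp add: minv flip: matrix_vector_mul_assoc)
         (metis dot_lmul_matrix inner_commute)
  qed
  have mat1: "matrix_inv (mat 1 :: real^'n^'n) = mat 1"
    by (rule matrix_inv_eqI) simp
  have dens: "ennreal \<bar>det B\<bar> * f (B ** transpose B) (B *v z) = f (mat 1) z" for z
    using assms
    by (simp add: f_def quad mat1 det_mul real_sqrt_mult flip: ennreal_mult' power2_eq_square)
  fix S :: "(real^'n) set"
  assume "S \<in> sets (gaussian \<mu> (B ** transpose B))"
  then have [measurable]: "S \<in> sets borel"
    by simp
  have "emeasure (gaussian \<mu> (B ** transpose B)) S
      = (\<integral>\<^sup>+y. f (B ** transpose B) (y - \<mu>) * indicator S y \<partial>lborel)"
    by (simp add: gf emeasure_density)
  also have "\<dots> = (\<integral>\<^sup>+x. f (B ** transpose B) x * indicator S (\<mu> + x) \<partial>lborel)"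
    by (subst lborel_distr_plus[of \<mu>, symmetric]) (simp add: nn_integral_distr)
  also have "\<dots> = (\<integral>\<^sup>+z. ennreal \<bar>det B\<bar> * (f (B ** transpose B) (B *v z) * indicator S (\<mu> + B *v z)) \<partial>lborel)"
    by (subst nn_integral_lborel_matrix[OF assms]) (simp_all add: nn_integral_cmult)
  also have "\<dots> = (\<integral>\<^sup>+z. f (mat 1) z * indicator S (\<mu> + B *v z) \<partial>lborel)"
    by (simp add: dens flip: mult.assoc)
  also have "\<dots> = (\<integral>\<^sup>+z. f (mat 1) z * indicator ((\<lambda>z. \<mu> + B *v z) -` S) z \<partial>lborel)"
    by (simp add: indicator_def vimage_def)
  also have "\<dots> = emeasure (gaussian 0 (mat 1)) ((\<lambda>z. \<mu> + B *v z) -` S)"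
    using measurable_sets_borel[of "\<lambda>z. \<mu> + B *v z" borel S]
    by (simp add: gf emeasure_density)
  finally show "emeasure (gaussian \<mu> (B ** transpose B)) S
      = emeasure (distr (gaussian 0 (mat 1)) borel (\<lambda>z. \<mu> + B *v z)) S"
    by (simp add: emeasure_distr)
qed simp

text \<open>Fatou's lemma for events, in the form in which it is used along sequences of factors.\<close>

lemma prob_le_of_AE_eventually:
  assumes "prob_space M" "B \<in> sets M" "\<And>i::nat. Bs i \<in> sets M"
    and ev: "AE z in M. z \<in> B \<longrightarrow> (\<forall>\<^sub>F i in sequentially. z \<in> Bs i)"
    and le: "\<forall>\<^sub>F i in sequentially. measure M (Bs i) \<le> p"
  shows "measure M B \<le> p"
proof -
  interpret prob_space M by fact
  define U where "U j = (\<Inter>i\<in>{j..}. Bs i)" for j :: nat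
  have [measurable]: "B \<in> sets M" "Bs i \<in> sets M" for i
    using assms by auto
  have U [measurable]: "U j \<in> sets M" for j
    unfolding U_def by measurable
  have "(\<lambda>j. measure M (U j)) \<longlonglongrightarrow> measure M (\<Union>j. U j)"
    by (rule finite_Lim_measure_incseq) (auto simp: incseq_def U_def)
  moreover have "measure M (U j) \<le> measure M (Bs j)" for j
    by (rule finite_measure_mono) (auto simp: U_def)
  then have "\<forall>\<^sub>F j in sequentially. measure M (U j) \<le> p"
    using le by (auto elim!: eventually_mono intro: order_trans)
  ultimately have "measure M (\<Union>j. U j) \<le> p"
    by (rule tendsto_upperbound) simp
  moreover have "measure M B \<le> measure M (\<Union>j. U j)"
    using ev by (intro finite_measure_mono_AE) (auto simp: U_def eventually_sequentially)
  ultimately show ?thesis by linarith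
qed

lemma borel_vimage_matrix: "S \<in> sets borel \<Longrightarrow> {z. (A :: real^'n^'n) *v z \<in> S} \<in> sets borel"
  using measurable_sets_borel[OF borel_measurable_matrix_vector_mult[of A]] by (simp add: vimage_def)

lemma emeasure_lborel_open_nonzero:
  fixes S :: "(real^'n) set"
  assumes "open S" "S \<noteq> {}"
  shows "emeasure lborel S \<noteq> 0"
proof
  assume "emeasure lborel S = 0"
  then have "S \<in> null_sets lborel"
    using assms(1) by auto
  then have "negligible S"
    using null_sets_completionI negligible_iff_null_sets by blast
  then show False
    using assms open_not_negligible by blast
qed

text \<open>An invertible linear map preserves null sets, and so does the passage to an equivalent measure.\<close>

lemma measure_std_pos:
  fixes A :: "real^'n^'n"
  assumes "det A \<noteq> 0" "emeasure lborel S \<noteq> 0"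
  shows "measure (gaussian 0 (mat 1)) {z. A *v z \<in> S} > 0"
proof (rule ccontr)
  interpret prob_space "gaussian (0 :: real^'n) (mat 1)" by (rule prob_space_standard_gaussian)
  have S[measurable]: "S \<in> sets borel"
    using assms(2) emeasure_notin_sets[of S lborel] by auto
  assume "\<not> ?thesis"
  then have "measure (gaussian 0 (mat 1)) {z. A *v z \<in> S} = 0"
    by (simp add: zero_less_measure_iff)
  then have "AE z in gaussian 0 (mat 1). \<not> A *v z \<in> S"
    by (subst (asm) prob_eq_0) auto
  then have "AE y in lborel. y \<notin> S"
    using AE_lborel_matrix_iff[OF assms(1), of "\<lambda>y. y \<notin> S"] by (simp add: AE_standard_gaussian_iff)
  then have "emeasure lborel S = 0"
    by (subst (asm) AE_iff_measurable[of S]) auto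
  with assms(2) show False
    by simp
qed

section \<open>Limits and factorizations of matrices\<close>

lemma tendsto_matrix_vector_mult [tendsto_intros]:
  fixes f :: "'a \<Rightarrow> real^'m^'n"
  assumes "(f \<longlongrightarrow> A) F" "(g \<longlongrightarrow> x) F"
  shows "((\<lambda>t. f t *v g t) \<longlongrightarrow> A *v x) F"
  unfolding matrix_vector_mult_def by (intro tendsto_intros tendsto_vec_lambda assms)

lemma tendsto_matrix_mult [tendsto_intros]:
  fixes f :: "'a \<Rightarrow> real^'m^'n" and g :: "'a \<Rightarrow> real^'k^'m"
  assumes "(f \<longlongrightarrow> A) F" "(g \<longlongrightarrow> B) F"
  shows "((\<lambda>t. f t ** g t) \<longlongrightarrow> A ** B) F"
  unfolding matrix_matrix_mult_def by (intro tendsto_intros tendsto_vec_lambda assms)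

lemma tendsto_transpose [tendsto_intros]:
  fixes f :: "'a \<Rightarrow> real^'m^'n"
  assumes "(f \<longlongrightarrow> A) F"
  shows "((\<lambda>t. transpose (f t)) \<longlongrightarrow> transpose A) F"
  unfolding transpose_def by (intro tendsto_intros tendsto_vec_lambda assms)

lemma tendsto_det [tendsto_intros]:
  fixes f :: "'a \<Rightarrow> real^'n^'n"
  assumes "(f \<longlongrightarrow> A) F"
  shows "((\<lambda>t. det (f t)) \<longlongrightarrow> det A) F"
  unfolding det_def by (intro tendsto_intros assms)

text \<open>Cramer's rule expresses the inverse through determinants, which are polynomials in the entries.\<close>

lemma tendsto_matrix_inv_mult [tendsto_intros]:
  fixes f :: "'a \<Rightarrow> real^'n^'n"
  assumes f: "(f \<longlongrightarrow> A) F" and g: "(g \<longlongrightarrow> x) F" and nz: "det A \<noteq> 0"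
  shows "((\<lambda>t. matrix_inv (f t) *v g t) \<longlongrightarrow> matrix_inv A *v x) F"
proof -
  define C where "C B b = (\<chi> k. det (\<chi> i j. if j = k then b $ i else B $ i $ j) / det B)"
    for B :: "real^'n^'n" and b
  have C: "matrix_inv B *v b = C B b" if "det B \<noteq> 0" for B b
    using cramer[OF that, of "matrix_inv B *v b" b] that
    by (simp add: C_def matrix_vector_mul_assoc matrix_inv_right)
  have "((\<lambda>t. if j = k then g t $ i else f t $ i $ j) \<longlongrightarrow> (if j = k then x $ i else A $ i $ j)) F" for i j k
    by (cases "j = k") (auto intro!: tendsto_intros f g)
  then have "((\<lambda>t. C (f t) (g t)) \<longlongrightarrow> C A x) F"
    unfolding C_def by (intro tendsto_intros tendsto_vec_lambda f nz)
  moreover have "\<forall>\<^sub>F t in F. C (f t) (g t) = matrix_inv (f t) *v g t"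
    using tendsto_imp_eventually_ne[OF tendsto_det[OF f] nz] by eventually_elim (simp add: C)
  ultimately show ?thesis
    by (simp add: C[OF nz] tendsto_cong)
qed

lemma matrix_mult_scaleR:
  fixes A :: "real^'m^'n" and B :: "real^'k^'m"
  shows "(c *\<^sub>R A) ** B = c *\<^sub>R (A ** B)" and "A ** (c *\<^sub>R B) = c *\<^sub>R (A ** B)"
  by (simp_all add: matrix_matrix_mult_def vec_eq_iff sum_distrib_left mult_ac)

lemma inner_matrix_transpose:
  fixes A :: "real^'m^'n"
  shows "x \<bullet> (A *v y) = (transpose A *v x) \<bullet> y"
  by (simp add: dot_lmul_matrix)

lemma det_nonzero_of_mult_eq_mat1:
  fixes A :: "real^'n^'n"
  assumes "A ** B = mat 1"
  shows "det A \<noteq> 0" "det B \<noteq> 0"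
  using arg_cong[OF assms, of det] by (auto simp: det_mul)

text \<open>Gram--Schmidt for the inner product x' S y, one vector at a time. As long as k is less than
  the dimension, some nonzero vector is orthogonal to the k vectors S u_i.\<close>

lemma pos_definite_orthonormal_family:
  fixes S :: "real^'n^'n"
  assumes "pos_definite S" and "k \<le> CARD('n)"
  shows "\<exists>u :: nat \<Rightarrow> real^'n. \<forall>i<k. \<forall>j<k. u i \<bullet> (S *v u j) = of_bool (i = j)"
  using assms(2)
proof (induction k)
  case (Suc k)
  then obtain u :: "nat \<Rightarrow> real^'n" where u: "\<And>i j. i < k \<Longrightarrow> j < k \<Longrightarrow> u i \<bullet> (S *v u j) = of_bool (i = j)"
    by auto
  have sym: "x \<bullet> (S *v y) = y \<bullet> (S *v x)" for x y
    using assms(1) by (metis inner_commute inner_matrix_transpose pos_definite_def)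
  have "dim ((\<lambda>i. S *v u i) ` {..<k}) \<le> card ((\<lambda>i. S *v u i) ` {..<k})"
    by (intro dim_le_card' finite_imageI) simp
  also have "\<dots> \<le> k"
    using card_image_le[of "{..<k}"] by simp
  finally have "dim ((\<lambda>i. S *v u i) ` {..<k}) < DIM(real^'n)"
    using Suc.prems by simp
  then obtain x where x: "x \<noteq> 0" "\<And>y. y \<in> span ((\<lambda>i. S *v u i) ` {..<k}) \<Longrightarrow> orthogonal x y"
    by (rule orthogonal_to_subspace_exists) blast
  have orth: "x \<bullet> (S *v u i) = 0" if "i < k" for i
    using x(2)[of "S *v u i"] that by (auto simp: orthogonal_def intro: span_base)
  have pos: "x \<bullet> (S *v x) > 0"
    using assms(1) x(1) by (simp add: pos_definite_def)
  define v where "v = (1 / sqrt (x \<bullet> (S *v x))) *\<^sub>R x"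
  have v: "v \<bullet> (S *v v) = 1" "\<And>i. i < k \<Longrightarrow> v \<bullet> (S *v u i) = 0" "\<And>i. i < k \<Longrightarrow> u i \<bullet> (S *v v) = 0"
    using pos orth by (simp_all add: v_def sym[of "u _"] matrix_vector_mult_scaleR)
  have "(u(k := v)) i \<bullet> (S *v (u(k := v)) j) = of_bool (i = j)" if "i < Suc k" "j < Suc k" for i j
    using that u v by (auto simp: less_Suc_eq)
  then show ?case
    by blast
qed simp

text \<open>An orthonormal family of full size, as the rows of B, gives B S B' = I, and the factor is
  A = B^-1.\<close>

lemma pos_definite_factorization:
  fixes S :: "real^'n^'n"
  assumes "pos_definite S"
  obtains A where "A ** transpose A = S" "det A \<noteq> 0"
proof -
  obtain u :: "nat \<Rightarrow> real^'n" where
    u: "\<And>i j. i < CARD('n) \<Longrightarrow> j < CARD('n) \<Longrightarrow> u i \<bullet> (S *v u j) = of_bool (i = j)"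
    using pos_definite_orthonormal_family[OF assms order_refl] by blast
  obtain h where h: "bij_betw h (UNIV :: 'n set) {0..<CARD('n)}"
    using ex_bij_betw_finite_nat[OF finite] by blast
  define B where "B = (\<chi> i. u (h i))"
  have "h i < CARD('n)" "h i = h j \<longleftrightarrow> i = j" for i j
    using h by (auto simp: bij_betw_def inj_on_def)
  then have "row i B \<bullet> (S *v row j B) = of_bool (i = j)" for i j
    by (simp add: B_def row_def u)
  moreover have "(B ** (S ** transpose B)) $ i $ j = row i B \<bullet> (S *v row j B)" for i j
    by (simp add: matrix_matrix_mult_def matrix_vector_mult_def transpose_def inner_vec_def row_def)
  ultimately have "(B ** (S ** transpose B)) $ i $ j = mat 1 $ i $ j" for i j
    by (simp add: mat_def)
  then have BSB: "B ** (S ** transpose B) = mat 1"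
    by (simp add: vec_eq_iff)
  define A where "A = matrix_inv B"
  have AB: "A ** B = mat 1"
    using det_nonzero_of_mult_eq_mat1[OF BSB] by (simp add: A_def matrix_inv_left)
  have "A ** transpose A = A ** (B ** (S ** transpose B)) ** transpose A"
    by (simp add: BSB)
  also have "\<dots> = (A ** B) ** S ** transpose (A ** B)"
    by (simp add: matrix_mul_assoc matrix_transpose_mul)
  also have "\<dots> = S"
    by (simp add: AB)
  finally show thesis
    using that det_nonzero_of_mult_eq_mat1[OF AB] by blast
qed

text \<open>The diagonal entries of A A' are the squared norms of the rows of A. Hence factors of a bounded
  set of matrices are bounded.\<close>

lemma norm_sq_le_of_factorization:
  fixes A :: "real^'m^'n"
  shows "(norm A)\<^sup>2 \<le> CARD('n) * norm (A ** transpose A)"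
proof -
  have "(A ** transpose A) $ i $ i = (norm (A $ i))\<^sup>2" for i
    by (simp add: matrix_matrix_mult_def transpose_def power2_norm_eq_inner inner_vec_def)
  moreover have "\<bar>(A ** transpose A) $ i $ i\<bar> \<le> norm (A ** transpose A)" for i
    using component_le_norm_cart[of "(A ** transpose A) $ i" i]
      Finite_Cartesian_Product.norm_nth_le[of "A ** transpose A" i] by linarith
  ultimately have "(norm (A $ i))\<^sup>2 \<le> norm (A ** transpose A)" for i
    by (metis abs_le_D1)
  then have "(\<Sum>i\<in>UNIV. (norm (A $ i))\<^sup>2) \<le> (\<Sum>i\<in>(UNIV::'n set). norm (A ** transpose A))"
    by (intro sum_mono) auto
  then show ?thesis
    by (simp add: norm_vec_def L2_set_def sum_nonneg)
qed

lemma bounded_factors: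
  fixes A :: "nat \<Rightarrow> real^'m^'n"
  assumes "bounded (range (\<lambda>i. A i ** transpose (A i)))"
  shows "bounded (range A)"
proof -
  obtain K where K: "\<And>i. norm (A i ** transpose (A i)) \<le> K"
    using assms by (auto simp: bounded_iff)
  have "norm (A i) \<le> sqrt (CARD('n) * K)" for i
    using norm_sq_le_of_factorization[of "A i"] K[of i]
    by (intro real_le_rsqrt) (meson mult_left_mono of_nat_0_le_iff order_trans)
  then show ?thesis
    by (auto simp: bounded_iff)
qed

lemma orthogonal_comp_disjoint:
  assumes "x \<in> U" "x \<in> U\<^sup>\<bottom>"
  shows "x = 0"
proof -
  have "orthogonal x x"
    using assms unfolding orthogonal_comp_def by blast
  then show ?thesis
    by (simp add: orthogonal_self)
qed

lemma
  fixes L :: "(real^'n) set"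
  assumes L: "subspace L"
  shows orth_proj_matrix_in: "orth_proj_matrix L *v x \<in> L"
    and orth_proj_matrix_diff: "x - orth_proj_matrix L *v x \<in> L\<^sup>\<bottom>"
    and orth_proj_matrix_transpose: "transpose (orth_proj_matrix L) = orth_proj_matrix L"
proof -
  have uniq: "p = q" if "p \<in> L" "q \<in> L" "x - p \<in> L\<^sup>\<bottom>" "x - q \<in> L\<^sup>\<bottom>" for p q x
  proof -
    have "p - q \<in> L"
      using L that by (simp add: subspace_diff)
    moreover have "p - q = (x - q) - (x - p)"
      by simp
    then have "p - q \<in> L\<^sup>\<bottom>"
      by (metis subspace_diff subspace_orthogonal_comp that(3,4))
    ultimately have "p - q = 0"
      by (rule orthogonal_comp_disjoint)
    then show "p = q"
      by simp
  qed
  have ex: "\<exists>p. p \<in> L \<and> x - p \<in> L\<^sup>\<bottom>" for x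
  proof -
    obtain y z where "y \<in> span L" "\<And>w. w \<in> span L \<Longrightarrow> orthogonal z w" "x = y + z"
      using orthogonal_subspace_decomp_exists by blast
    moreover have "span L = L"
      using L by (simp add: span_eq_iff)
    ultimately show ?thesis
      by (intro exI[of _ y]) (auto simp: orthogonal_comp_def orthogonal_commute)
  qed
  have oproj: "orth_proj L x \<in> L \<and> x - orth_proj L x \<in> L\<^sup>\<bottom>" for x
    unfolding orth_proj_def by (rule theI') (use ex[of x] uniq in blast)
  have eqI: "orth_proj L x = p" if "p \<in> L" "x - p \<in> L\<^sup>\<bottom>" for x p
    using that oproj uniq by blast
  have lin: "linear (orth_proj L)"
  proof (rule linearI)
    fix x y
    have "x + y - (orth_proj L x + orth_proj L y) = (x - orth_proj L x) + (y - orth_proj L y)"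
      by simp
    then show "orth_proj L (x + y) = orth_proj L x + orth_proj L y"
      by (intro eqI) (metis oproj L subspace_add subspace_orthogonal_comp)+
  next
    fix c x
    have "c *\<^sub>R x - c *\<^sub>R orth_proj L x = c *\<^sub>R (x - orth_proj L x)"
      by (simp add: scaleR_diff_right)
    then show "orth_proj L (c *\<^sub>R x) = c *\<^sub>R orth_proj L x"
      by (intro eqI) (metis oproj L subspace_scale subspace_orthogonal_comp)+
  qed
  have works: "orth_proj_matrix L *v x = orth_proj L x" for x
    by (simp add: orth_proj_matrix_def lin matrix_works)
  show "orth_proj_matrix L *v x \<in> L" "x - orth_proj_matrix L *v x \<in> L\<^sup>\<bottom>"
    using oproj by (simp_all add: works)
  have "orth_proj L x \<bullet> y = x \<bullet> orth_proj L y" for x y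
  proof -
    have "orth_proj L x \<bullet> (y - orth_proj L y) = 0" "orth_proj L y \<bullet> (x - orth_proj L x) = 0"
      using oproj[of x] oproj[of y] by (auto simp: orthogonal_comp_def orthogonal_def)
    then show ?thesis
      by (simp add: inner_diff_right inner_commute)
  qed
  then have "x \<bullet> (transpose (orth_proj_matrix L) *v y) = x \<bullet> (orth_proj_matrix L *v y)" for x y
    unfolding inner_matrix_transpose[of x "transpose (orth_proj_matrix L)"] transpose_transpose works
    by simp
  then have "transpose (orth_proj_matrix L) *v y = orth_proj_matrix L *v y" for y
    by (metis vector_eq_ldot)
  then show "transpose (orth_proj_matrix L) = orth_proj_matrix L"
    unfolding matrix_eq by blast
qed

lemma subspace_col_span: "subspace (col_span A)"
  by (simp add: col_span_def)

lemma matrix_vector_mult_in_col_span: "(A :: real^'m^'n) *v x \<in> col_span A"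
  unfolding col_span_def by (rule matrix_vector_mult_in_columnspace)

text \<open>The transpose of B is injective on M; let K be the image of M under it. Then K^\<bottom> and
  M^\<bottom> have the same dimension, and E projects onto K^\<bottom> and then maps it isometrically onto
  M^\<bottom>. If (B + E)x = 0, both summands vanish, because they are orthogonal; Bx = 0 puts x into
  K^\<bottom>, where E is injective.\<close>

lemma invertible_completion:
  fixes B :: "real^'n^'n"
  assumes M: "subspace M" and BM: "\<And>x. B *v x \<in> M"
    and inj: "inj_on ((*v) (B ** transpose B)) M"
  obtains E where "\<And>x. E *v x \<in> M\<^sup>\<bottom>" "det (B + E) \<noteq> 0"
proof -
  define K where "K = (*v) (transpose B) ` M"
  have K: "subspace K"
    unfolding K_def by (rule linear_subspace_image) (auto simp: M)
  have comp: "U\<^sup>\<bottom> = {y \<in> UNIV. \<forall>x\<in>U. orthogonal x y}" for U :: "(real^'n) set"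
    by (simp add: orthogonal_comp_def)
  have dim_comp: "dim (U\<^sup>\<bottom>) + dim U = CARD('n)" if "subspace U" for U :: "(real^'n) set"
    using dim_subspace_orthogonal_to_vectors[OF that subspace_UNIV] unfolding comp by simp
  have "inj_on ((*v) (transpose B)) M"
    using inj by (auto simp: inj_on_def simp flip: matrix_vector_mul_assoc)
  then have "dim K = dim M"
    unfolding K_def using M by (intro dim_image_eq) (simp_all add: span_eq_iff[THEN iffD2])
  then have dims: "dim (K\<^sup>\<bottom>) = dim (M\<^sup>\<bottom>)"
    using dim_comp[OF K] dim_comp[OF M] by simp
  obtain f where f: "linear f" "f ` (K\<^sup>\<bottom>) = M\<^sup>\<bottom>" "\<And>x. x \<in> K\<^sup>\<bottom> \<Longrightarrow> norm (f x) = norm x"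
    using isometries_subspaces[OF subspace_orthogonal_comp subspace_orthogonal_comp dims] by metis
  define E where "E = matrix f ** orth_proj_matrix (K\<^sup>\<bottom>)"
  have E: "E *v x = f (orth_proj_matrix (K\<^sup>\<bottom>) *v x)" for x
    by (simp add: E_def f(1) matrix_works flip: matrix_vector_mul_assoc)
  have EM: "E *v x \<in> M\<^sup>\<bottom>" for x
    unfolding E f(2)[symmetric] using orth_proj_matrix_in[OF subspace_orthogonal_comp] by blast
  have "x = 0" if "(B + E) *v x = 0" for x
  proof -
    have sum: "B *v x + E *v x = 0"
      using that by (simp add: matrix_vector_mult_add_rdistrib)
    then have "E *v x = (-1) *\<^sub>R (B *v x)"
      by (simp add: add_eq_0_iff)
    then have "E *v x \<in> M"
      using BM M subspace_scale by metis
    then have Ex: "E *v x = 0"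
      using EM[of x] by (rule orthogonal_comp_disjoint)
    then have Bx: "B *v x = 0"
      using sum by simp
    have x: "x \<in> K\<^sup>\<bottom>"
      using Bx by (auto simp: K_def orthogonal_comp_def orthogonal_def inner_matrix_transpose[symmetric]
         simp del: transpose_matrix_vector)
    have "x - orth_proj_matrix (K\<^sup>\<bottom>) *v x \<in> K\<^sup>\<bottom>"
      by (intro subspace_diff x orth_proj_matrix_in subspace_orthogonal_comp)
    then have "x - orth_proj_matrix (K\<^sup>\<bottom>) *v x = 0"
      using orth_proj_matrix_diff[OF subspace_orthogonal_comp] by (rule orthogonal_comp_disjoint)
    then have "orth_proj_matrix (K\<^sup>\<bottom>) *v x = x"
      by simp
    then show "x = 0"
      using Ex f(3)[OF x] by (simp add: E)
  qed
  then have "inj ((*v) (B + E))"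
    by (simp add: linear_injective_0)
  then have "det (B + E) \<noteq> 0"
    using det_nz_iff_inj[of "(*v) (B + E)"] by simp
  with EM show thesis
    using that by blast
qed

text \<open>The deterministic core of the treatment of singular limits. Modulo the column space L of the
  limit, the rescaled factors t_i A (\<psi> i) agree with matrices A'_i that have an invertible limit:
  A'_i is the part of t_i A (\<psi> i) in L^\<bottom> plus a fixed matrix with range in L. Here
  t_i = 1 / sqrt s, and t_i \<longrightarrow> \<infinity> because the projected matrices vanish in the limit while
  their quotients by s do not.\<close>

lemma renormalized_factors:
  fixes S A :: "nat \<Rightarrow> real^'n^'n"
  assumes AS: "\<And>m. A m ** transpose (A m) = S m"
    and lim: "S \<longlonglongrightarrow> \<Sigma>'" and sing: "det \<Sigma>' = 0"
    and \<phi>: "strict_mono (\<phi> :: nat \<Rightarrow> nat)" and s: "\<And>i. 0 < s (\<phi> i)"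
    and D: "(\<lambda>i. (1 / s (\<phi> i)) *\<^sub>R
       (orth_proj_matrix ((col_span \<Sigma>')\<^sup>\<bottom>) ** S (\<phi> i) ** orth_proj_matrix ((col_span \<Sigma>')\<^sup>\<bottom>)))
       \<longlonglongrightarrow> D"
    and inj: "inj_on ((*v) D) ((col_span \<Sigma>')\<^sup>\<bottom>)"
  obtains \<psi> A' A'' t where "strict_mono (\<psi> :: nat \<Rightarrow> nat)" "A' \<longlonglongrightarrow> A''" "det A'' \<noteq> 0"
    "\<And>i. 0 < t i" "filterlim t at_top sequentially"
    "\<And>i z. t i *\<^sub>R (A (\<psi> i) *v z) - A' i *v z \<in> col_span \<Sigma>'"
proof -
  define L where "L = col_span \<Sigma>'"
  define P where "P = orth_proj_matrix (L\<^sup>\<bottom>)"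
  have L: "subspace L" "subspace (L\<^sup>\<bottom>)" "(L\<^sup>\<bottom>)\<^sup>\<bottom> = L"
    by (simp_all add: L_def subspace_col_span subspace_orthogonal_comp orthogonal_comp_self)
  have P: "P *v x \<in> L\<^sup>\<bottom>" "x - P *v x \<in> L" "transpose P = P" for x
    using orth_proj_matrix_in[OF L(2)] orth_proj_matrix_diff[OF L(2), of x] orth_proj_matrix_transpose[OF L(2)] L(3)
    by (simp_all add: P_def)
  have "transpose (S m) = S m" for m
    by (simp add: AS[symmetric] matrix_transpose_mul)
  then have sym: "transpose \<Sigma>' = \<Sigma>'"
    using LIMSEQ_unique[OF tendsto_transpose[OF lim]] lim by simp
  \<comment> \<open>As the limit is symmetric, its kernel is the orthogonal complement of its column space.\<close>
  have kernel: "\<Sigma>' *v x = 0 \<longleftrightarrow> x \<in> L\<^sup>\<bottom>" for x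
  proof
    assume "\<Sigma>' *v x = 0"
    have "orthogonal y x" if y_col: "y \<in> columns \<Sigma>'" for y
    proof -
      obtain j where "y = column j \<Sigma>'"
        using y_col unfolding columns_def by blast
      then have y: "y = \<Sigma>' *v axis j 1"
        by (simp add: matrix_vector_mult_basis)
      have "x \<bullet> y = 0"
        unfolding y inner_matrix_transpose sym \<open>\<Sigma>' *v x = 0\<close> by simp
      then show ?thesis
        by (simp add: orthogonal_def inner_commute)
    qed
    then have "orthogonal x y" if "y \<in> span (columns \<Sigma>')" for y
      by (intro orthogonal_to_span[OF that]) (simp add: orthogonal_commute)
    then show "x \<in> L\<^sup>\<bottom>"
      by (simp add: orthogonal_comp_def L_def col_span_def orthogonal_commute)
  next
    assume x: "x \<in> L\<^sup>\<bottom>"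
    have "\<Sigma>' *v (\<Sigma>' *v x) \<in> L"
      by (simp add: L_def matrix_vector_mult_in_col_span)
    then have "x \<bullet> (\<Sigma>' *v (\<Sigma>' *v x)) = 0"
      using x by (auto simp: orthogonal_comp_def orthogonal_def inner_commute)
    moreover have "x \<bullet> (\<Sigma>' *v (\<Sigma>' *v x)) = (\<Sigma>' *v x) \<bullet> (\<Sigma>' *v x)"
      using inner_matrix_transpose[of x \<Sigma>' "\<Sigma>' *v x"] by (simp only: sym)
    ultimately show "\<Sigma>' *v x = 0"
      by simp
  qed
  obtain x0 where x0: "x0 \<noteq> 0" "x0 \<in> L\<^sup>\<bottom>"
    using sing kernel det_nz_iff_inj[of "(*v) \<Sigma>'"] linear_injective_0[of "(*v) \<Sigma>'"] by auto
  have "x0 - P *v x0 \<in> L\<^sup>\<bottom>"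
    using x0 P(1) by (simp add: subspace_diff L)
  with P(2) have "x0 - P *v x0 = 0"
    by (rule orthogonal_comp_disjoint)
  then have Px0: "P *v x0 = x0"
    by simp
  define a where "a i = norm ((P ** S (\<phi> i) ** P) *v x0)" for i
  have "(\<lambda>i. (P ** S (\<phi> i) ** P) *v x0) \<longlonglongrightarrow> (P ** \<Sigma>' ** P) *v x0"
    by (intro tendsto_intros LIMSEQ_subseq_LIMSEQ[OF lim \<phi>, unfolded o_def])
  moreover have "(P ** \<Sigma>' ** P) *v x0 = 0"
    using x0(2) kernel[of x0] by (simp add: Px0 flip: matrix_vector_mul_assoc)
  ultimately have a: "a \<longlonglongrightarrow> 0"
    unfolding a_def by (metis tendsto_norm_zero)
  define Ds where "Ds i = (1 / s (\<phi> i)) *\<^sub>R (P ** S (\<phi> i) ** P)" for i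
  have Ds: "Ds \<longlonglongrightarrow> D"
    using D unfolding Ds_def[abs_def] P_def L_def .
  have "D *v x0 \<noteq> D *v 0"
    using inj x0 L(2) subspace_0 unfolding inj_on_def L_def by metis
  then have Dx0: "norm (D *v x0) \<noteq> 0"
    by simp
  have "(\<lambda>i. norm (Ds i *v x0)) \<longlonglongrightarrow> norm (D *v x0)"
    by (intro tendsto_intros Ds)
  moreover have "norm (Ds i *v x0) = a i / s (\<phi> i)" for i
    using s[of i] by (simp add: Ds_def a_def scaleR_matrix_vector_assoc[symmetric])
  ultimately have as: "(\<lambda>i. a i / s (\<phi> i)) \<longlonglongrightarrow> norm (D *v x0)"
    by simp
  \<comment> \<open>The norms a_i tend to zero and a_i / s has a nonzero limit, which forces s \<longrightarrow> 0.\<close>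
  have "(\<lambda>i. a i / (a i / s (\<phi> i))) \<longlonglongrightarrow> 0 / norm (D *v x0)"
    by (intro tendsto_divide a as Dx0)
  moreover have "\<forall>\<^sub>F i in sequentially. a i / (a i / s (\<phi> i)) = s (\<phi> i)"
    using tendsto_imp_eventually_ne[OF as Dx0] by eventually_elim auto
  ultimately have s0: "(\<lambda>i. s (\<phi> i)) \<longlonglongrightarrow> 0"
    by (simp add: tendsto_cong)
  define t where "t i = 1 / sqrt (s (\<phi> i))" for i
  have t_pos: "0 < t i" and t_sq: "t i * t i = 1 / s (\<phi> i)" for i
    using s[of i] by (simp_all add: t_def)
  have "filterlim (\<lambda>i. sqrt (s (\<phi> i))) (at_right 0) sequentially"
    using tendsto_real_sqrt[OF s0] s less_imp_neq[OF s, THEN not_sym]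
    by (auto simp: filterlim_at intro!: always_eventually)
  then have t_inf: "filterlim t at_top sequentially"
    unfolding t_def inverse_eq_divide[symmetric]
    by (rule filterlim_compose[OF filterlim_inverse_at_top_right])
  define Bs where "Bs i = t i *\<^sub>R (P ** A (\<phi> i))" for i
  \<comment> \<open>Thus the matrices B_i are factors of a convergent sequence, hence bounded.\<close>
  have BsDs: "Bs i ** transpose (Bs i) = Ds i" for i
  proof -
    have "Bs i ** transpose (Bs i) = (t i * t i) *\<^sub>R (P ** A (\<phi> i) ** transpose (P ** A (\<phi> i)))"
      by (simp add: Bs_def transpose_scalar matrix_mult_scaleR)
    also have "P ** A (\<phi> i) ** transpose (P ** A (\<phi> i)) = P ** (A (\<phi> i) ** transpose (A (\<phi> i))) ** P"
      by (simp add: matrix_transpose_mul P matrix_mul_assoc)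
    finally show ?thesis
      by (simp add: Ds_def t_sq AS)
  qed
  have "bounded (range Bs)"
    by (rule bounded_factors) (simp add: BsDs convergent_imp_bounded[OF Ds])
  then obtain B \<rho> where \<rho>: "strict_mono (\<rho> :: nat \<Rightarrow> nat)" and B: "(Bs \<circ> \<rho>) \<longlonglongrightarrow> B"
    using bounded_imp_convergent_subsequence by blast
  have "(\<lambda>i. Bs (\<rho> i) ** transpose (Bs (\<rho> i))) \<longlonglongrightarrow> B ** transpose B"
    using B by (intro tendsto_intros) (simp_all add: o_def)
  then have BD: "B ** transpose B = D"
    using LIMSEQ_unique LIMSEQ_subseq_LIMSEQ[OF Ds \<rho>] by (simp add: BsDs o_def) blast
  have "B *v x \<in> L\<^sup>\<bottom>" for x
  proof (rule closed_sequentially[OF closed_subspace[OF L(2)]])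
    show "(\<lambda>i. (Bs \<circ> \<rho>) i *v x) \<longlonglongrightarrow> B *v x"
      by (intro tendsto_intros B)
    show "(Bs \<circ> \<rho>) i *v x \<in> L\<^sup>\<bottom>" for i
      using P(1) L(2) by (simp add: Bs_def subspace_scale scaleR_matrix_vector_assoc[symmetric] matrix_vector_mul_assoc[symmetric])
  qed
  then obtain E where E: "\<And>x. E *v x \<in> L" "det (B + E) \<noteq> 0"
    using invertible_completion[OF L(2), of B] inj L(3) by (auto simp: BD L_def)
  show thesis
  proof
    show "strict_mono (\<phi> \<circ> \<rho>)"
      using \<phi> \<rho> by (rule strict_mono_o)
    show "(\<lambda>i. Bs (\<rho> i) + E) \<longlonglongrightarrow> B + E"
      using B by (intro tendsto_intros) (simp add: o_def)
    show "det (B + E) \<noteq> 0"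
      by fact
    show "0 < (t \<circ> \<rho>) i" for i
      by (simp add: t_pos)
    show "filterlim (t \<circ> \<rho>) at_top sequentially"
      unfolding o_def using t_inf \<rho> by (rule filterlim_compose[OF _ filterlim_subseq])
    fix i z
    let ?y = "A (\<phi> (\<rho> i)) *v z"
    have "(t \<circ> \<rho>) i *\<^sub>R (A ((\<phi> \<circ> \<rho>) i) *v z) - (Bs (\<rho> i) + E) *v z = t (\<rho> i) *\<^sub>R (?y - P *v ?y) - E *v z"
      by (simp add: Bs_def matrix_vector_mult_add_rdistrib scaleR_diff_right scaleR_matrix_vector_assoc[symmetric]
          matrix_vector_mul_assoc[symmetric])
    also have "\<dots> \<in> L"
      by (rule subspace_diff[OF L(1) subspace_scale[OF L(1) P(2)] E(1)])
    finally show "(t \<circ> \<rho>) i *\<^sub>R (A ((\<phi> \<circ> \<rho>) i) *v z) - (Bs (\<rho> i) + E) *v z \<in> col_span \<Sigma>'"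
      by (simp add: L_def)
  qed
qed

lemma mem_col_span_iff: "\<mu> \<in> col_span (X :: real^'k^'n) \<longleftrightarrow> (\<exists>\<beta>. \<mu> = X *v \<beta>)"
proof
  assume "\<mu> \<in> col_span X"
  moreover have "columns X \<subseteq> range ((*v) X)"
    by (auto simp: columns_def image_iff) (metis matrix_vector_mult_basis)
  then have "col_span X \<subseteq> range ((*v) X)"
    unfolding col_span_def by (rule span_minimal) (simp add: linear_subspace_image)
  ultimately show "\<exists>\<beta>. \<mu> = X *v \<beta>"
    by blast
qed (auto simp: matrix_vector_mult_in_col_span)

lemma matrix_inv_scaleR:
  fixes M :: "real^'q^'q"
  assumes "det M \<noteq> 0" "c \<noteq> 0"
  shows "matrix_inv (c *\<^sub>R M) = (1 / c) *\<^sub>R matrix_inv M"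
  using assms by (intro matrix_inv_eqI)
    (simp add: matrix_mult_scaleR matrix_inv_right)

lemma det_scaleR_nonzero_iff:
  fixes M :: "real^'q^'q"
  assumes "c \<noteq> 0"
  shows "det (c *\<^sub>R M) = 0 \<longleftrightarrow> det M = 0"
  using assms scalar_invertible[of c M] scalar_invertible[of "1 / c" "c *\<^sub>R M"]
  by (auto simp: invertible_det_nz)

lemma nonneg_definite_inverse:
  fixes M :: "real^'q^'q"
  assumes "nonneg_definite M" "det M \<noteq> 0"
  shows "v \<bullet> (matrix_inv M *v v) \<ge> 0"
proof -
  let ?u = "matrix_inv M *v v"
  have "v = M *v ?u"
    using assms(2) by (simp add: matrix_vector_mul_assoc matrix_inv_right)
  then have "v \<bullet> ?u = ?u \<bullet> (M *v ?u)"
    by (metis inner_commute)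
  then show ?thesis
    using assms(1) by (simp add: nonneg_definite_def)
qed

text \<open>Along the ray s v the form is a quadratic polynomial in s with positive leading coefficient.\<close>

lemma quadratic_form_unbounded:
  fixes A :: "real^'q^'q"
  assumes "v \<bullet> (A *v v) > 0"
  shows "\<exists>s. (s *\<^sub>R v + w) \<bullet> (A *v (s *\<^sub>R v + w)) > C"
proof -
  define a where "a = v \<bullet> (A *v v)"
  define p where "p = v \<bullet> (A *v w) + w \<bullet> (A *v v)"
  define c where "c = w \<bullet> (A *v w)"
  \<comment> \<open>This choice gives s \<ge> 1 and s a = a + |p| + |c| + |C|, which dominates the lower order terms.\<close>
  define s where "s = 1 + (\<bar>p\<bar> + \<bar>c\<bar> + \<bar>C\<bar>) / a"
  have a: "a > 0"
    using assms by (simp add: a_def)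
  have s1: "s \<ge> 1"
    using a by (simp add: s_def)
  have sa: "s * a = a + \<bar>p\<bar> + \<bar>c\<bar> + \<bar>C\<bar>"
    using a by (simp add: s_def field_simps)
  have "C < a + \<bar>c\<bar> + \<bar>C\<bar> + c"
    using a by linarith
  also have "\<dots> \<le> s * (a + \<bar>c\<bar> + \<bar>C\<bar>) + c"
    using mult_right_mono[OF s1, of "a + \<bar>c\<bar> + \<bar>C\<bar>"] a by simp
  also have "\<dots> = s * (s * a) - s * \<bar>p\<bar> + c"
    unfolding sa by (simp add: algebra_simps)
  also have "\<dots> \<le> s * (s * a) + s * p + c"
    using mult_left_mono[of "- \<bar>p\<bar>" p s] s1 by simp
  also have "\<dots> = (s *\<^sub>R v + w) \<bullet> (A *v (s *\<^sub>R v + w))"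
    by (simp add: a_def p_def c_def matrix_vector_right_distrib matrix_vector_mult_scaleR inner_add_left
        inner_add_right algebra_simps)
  finally show ?thesis
    by blast
qed

section \<open>Subsequences, suprema and infima\<close>

text \<open>Either a subsequence converges, or a subsequence escapes to infinity in a limiting direction. The
  map u \<mapsto> u / (1 + norm u) embeds the space into the unit ball; the two cases are that of a limit
  point in the open ball and that of one on the sphere.\<close>

lemma compactify_sequence:
  fixes u :: "nat \<Rightarrow> 'a::euclidean_space"
  obtains (bounded) \<rho> v where "strict_mono (\<rho> :: nat \<Rightarrow> nat)" "(\<lambda>i. u (\<rho> i)) \<longlonglongrightarrow> v"
  | (unbounded) \<rho> v where "strict_mono (\<rho> :: nat \<Rightarrow> nat)" "filterlim (\<lambda>i. norm (u (\<rho> i))) at_top sequentially"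
      "norm v = 1" "(\<lambda>i. (1 / norm (u (\<rho> i))) *\<^sub>R u (\<rho> i)) \<longlonglongrightarrow> v"
proof -
  define y where "y i = (1 / (1 + norm (u i))) *\<^sub>R u i" for i
  have norm_y: "norm (y i) = norm (u i) / (1 + norm (u i))" for i
    by (simp add: y_def)
  have lt1: "norm (y i) < 1" for i
    unfolding norm_y by (smt (verit) divide_less_eq_1 norm_ge_zero)
  have u_y: "u i = (1 / (1 - norm (y i))) *\<^sub>R y i" for i
  proof -
    have pos: "1 + norm (u i) > 0"
      by (smt (verit) norm_ge_zero)
    then have "1 - norm (y i) = 1 / (1 + norm (u i))"
      by (simp add: norm_y field_simps)
    then show ?thesis
      using pos by (simp add: y_def)
  qed
  have "bounded (range y)"
    using lt1 by (auto simp: bounded_iff intro!: exI[of _ 1] less_imp_le)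
  then obtain v \<rho> where \<rho>: "strict_mono (\<rho> :: nat \<Rightarrow> nat)" and v: "(\<lambda>i. y (\<rho> i)) \<longlonglongrightarrow> v"
    using bounded_imp_convergent_subsequence[of y] by (auto simp: o_def)
  have lim1: "(\<lambda>i. 1 - norm (y (\<rho> i))) \<longlonglongrightarrow> 1 - norm v"
    by (intro tendsto_intros v)
  have "norm v \<le> 1"
    using LIMSEQ_le_const2[OF tendsto_norm[OF v]] lt1 less_imp_le by metis
  then consider "norm v < 1" | "norm v = 1"
    by linarith
  then show thesis
  proof cases
    case 1
    then have "(\<lambda>i. (1 / (1 - norm (y (\<rho> i)))) *\<^sub>R y (\<rho> i)) \<longlonglongrightarrow> (1 / (1 - norm v)) *\<^sub>R v"
      by (intro tendsto_intros v lim1) simp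
    then show thesis
      using bounded[OF \<rho>] by (simp add: u_y[symmetric])
  next
    case 2
    have "filterlim (\<lambda>i. 1 - norm (y (\<rho> i))) (at_right 0) sequentially"
      using lim1 2 lt1 less_imp_neq[OF lt1] by (auto simp: filterlim_at intro!: always_eventually)
    then have "filterlim (\<lambda>i. inverse (1 - norm (y (\<rho> i)))) at_top sequentially"
      by (rule filterlim_compose[OF filterlim_inverse_at_top_right])
    then have "filterlim (\<lambda>i. norm (y (\<rho> i)) * inverse (1 - norm (y (\<rho> i)))) at_top sequentially"
      by (rule filterlim_tendsto_pos_mult_at_top[OF tendsto_norm[OF v], rotated]) (simp add: 2)
    moreover have "norm (u i) = norm (y i) * inverse (1 - norm (y i))" for i
      using lt1[of i] by (subst u_y) (simp add: divide_inverse abs_of_pos)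
    ultimately have inf: "filterlim (\<lambda>i. norm (u (\<rho> i))) at_top sequentially"
      by simp
    have "(\<lambda>i. (1 / norm (y (\<rho> i))) *\<^sub>R y (\<rho> i)) \<longlonglongrightarrow> (1 / norm v) *\<^sub>R v"
      by (intro tendsto_intros v) (simp add: 2)
    moreover have "(1 / norm (y i)) *\<^sub>R y i = (1 / norm (u i)) *\<^sub>R u i" for i
    proof -
      have "1 + norm (u i) > 0"
        by (smt (verit) norm_ge_zero)
      then show ?thesis
        unfolding norm_y by (simp add: y_def)
    qed
    ultimately have "(\<lambda>i. (1 / norm (u (\<rho> i))) *\<^sub>R u (\<rho> i)) \<longlonglongrightarrow> v"
      by (simp add: 2)
    then show thesis
      using unbounded[OF \<rho> inf 2] by simp
  qed
qed

lemma tendsto_INF_1: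
  fixes f :: "nat \<Rightarrow> 'a \<Rightarrow> real"
  assumes ne: "\<And>m. I m \<noteq> {}" and f: "\<And>m x. x \<in> I m \<Longrightarrow> 0 \<le> f m x" "\<And>m x. x \<in> I m \<Longrightarrow> f m x \<le> 1"
    and ev: "\<And>\<epsilon>. \<epsilon> > 0 \<Longrightarrow> \<forall>\<^sub>F m in sequentially. \<forall>x\<in>I m. 1 - \<epsilon> \<le> f m x"
  shows "(\<lambda>m. INF x\<in>I m. f m x) \<longlonglongrightarrow> 1"
proof (rule order_tendstoI)
  fix a :: real assume "a < 1"
  then have "\<forall>\<^sub>F m in sequentially. \<forall>x\<in>I m. 1 - (1 - a) / 2 \<le> f m x"
    by (intro ev) simp
  then show "\<forall>\<^sub>F m in sequentially. a < (INF x\<in>I m. f m x)"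
  proof eventually_elim
    case (elim m)
    then have "1 - (1 - a) / 2 \<le> (INF x\<in>I m. f m x)"
      by (intro cINF_greatest ne) auto
    moreover have "a < 1 - (1 - a) / 2"
      using \<open>a < 1\<close> by (simp add: field_simps)
    ultimately show ?case
      by linarith
  qed
next
  fix a :: real assume "1 < a"
  have "(INF x\<in>I m. f m x) \<le> 1" for m
  proof -
    obtain x where "x \<in> I m"
      using ne by blast
    then have "(INF x\<in>I m. f m x) \<le> f m x"
      by (intro cINF_lower bdd_belowI2[of _ 0]) (auto simp: f)
    then show ?thesis
      using f(2)[OF \<open>x \<in> I m\<close>] by linarith
  qed
  then show "\<forall>\<^sub>F m in sequentially. (INF x\<in>I m. f m x) < a"
    using \<open>1 < a\<close> by (intro always_eventually allI) (meson le_less_trans)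
qed

lemma cSUP3_le:
  fixes f :: "'a \<Rightarrow> 'b \<Rightarrow> 'c \<Rightarrow> real"
  assumes "I \<noteq> {}" "J \<noteq> {}" "K \<noteq> {}" "\<And>x y z. x \<in> I \<Longrightarrow> y \<in> J \<Longrightarrow> z \<in> K \<Longrightarrow> f x y z \<le> c"
  shows "(SUP x\<in>I. SUP y\<in>J. SUP z\<in>K. f x y z) \<le> c"
  using assms by (intro cSUP_least) auto

lemma cINF3_ge:
  fixes f :: "'a \<Rightarrow> 'b \<Rightarrow> 'c \<Rightarrow> real"
  assumes "I \<noteq> {}" "J \<noteq> {}" "K \<noteq> {}" "\<And>x y z. x \<in> I \<Longrightarrow> y \<in> J \<Longrightarrow> z \<in> K \<Longrightarrow> c \<le> f x y z"
  shows "c \<le> (INF x\<in>I. INF y\<in>J. INF z\<in>K. f x y z)"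
  using assms by (intro cINF_greatest) auto

section \<open>The test statistic along a family of shifts\<close>

text \<open>The test statistic as a function of an observation y without the part of its mean that belongs to
  the null hypothesis, and of the shift w of R b(y) that stands for the deviation from it. Both the
  statistic itself (w = -r) and its distribution under every mean can be written in this way.\<close>

definition shifted_stat ::
  "real^'k^'q \<Rightarrow> (real^'n) set \<Rightarrow> (real^'n \<Rightarrow> real^'k) \<Rightarrow> (real^'n \<Rightarrow> real^'q^'q)
     \<Rightarrow> real^'n \<Rightarrow> real^'q \<Rightarrow> real" where
  "shifted_stat R N b \<Omega> y w =
     (if y \<in> N_star N \<Omega> then 0
      else (R *v b y + w) \<bullet> (matrix_inv (\<Omega> y) *v (R *v b y + w)))"

lemma test_stat_eq_shifted_stat: "test_stat R r N b \<Omega> y = shifted_stat R N b \<Omega> y (- r)"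
  by (simp add: test_stat_def shifted_stat_def)

locale equivariant_test =
  fixes X :: "real^'k^'n" and R :: "real^'k^'q" and r :: "real^'q"
    and N :: "(real^'n) set" and b :: "real^'n \<Rightarrow> real^'k" and \<Omega> :: "real^'n \<Rightarrow> real^'q^'q"
  assumes pair: "regular_equivariant_pair X N b \<Omega>"
    and rank_R: "rank R = CARD('q)"
begin

abbreviation "Ns \<equiv> N_star N \<Omega>"
abbreviation "T \<equiv> test_stat R r N b \<Omega>"
abbreviation "G \<equiv> shifted_stat R N b \<Omega>"
abbreviation "std \<equiv> gaussian (0 :: real^'n) (mat 1)"

lemma R_surj: "\<exists>\<gamma>. R *v \<gamma> = w"
  using rank_R full_rank_surjective[of R] by (metis surjD)

lemma b_equivariant: "y \<notin> N \<Longrightarrow> \<alpha> \<noteq> 0 \<Longrightarrow> b (\<alpha> *\<^sub>R y + X *v \<gamma>) = \<alpha> *\<^sub>R b y + \<gamma>"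
  and \<Omega>_equivariant: "y \<notin> N \<Longrightarrow> \<alpha> \<noteq> 0 \<Longrightarrow> \<Omega> (\<alpha> *\<^sub>R y + X *v \<gamma>) = \<alpha>\<^sup>2 *\<^sub>R \<Omega> y"
  and N_invariant: "y \<notin> N \<Longrightarrow> \<alpha> \<noteq> 0 \<Longrightarrow> \<alpha> *\<^sub>R y + X *v \<gamma> \<notin> N"
  using pair by (simp_all add: regular_equivariant_pair_def)

lemma notin_N_star: "y \<notin> Ns \<longleftrightarrow> y \<notin> N \<and> det (\<Omega> y) \<noteq> 0"
  by (auto simp: N_star_def)

lemma N_star_invariant:
  assumes "\<alpha> \<noteq> 0"
  shows "\<alpha> *\<^sub>R y + X *v \<gamma> \<in> Ns \<longleftrightarrow> y \<in> Ns"
proof -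
  have imp: "\<alpha> *\<^sub>R y + X *v \<gamma> \<notin> Ns" if "y \<notin> Ns" "\<alpha> \<noteq> 0" for y \<alpha> \<gamma>
    using that by (simp add: notin_N_star N_invariant \<Omega>_equivariant det_scaleR_nonzero_iff)
  have "(1 / \<alpha>) *\<^sub>R (\<alpha> *\<^sub>R y + X *v \<gamma>) + X *v ((- 1 / \<alpha>) *\<^sub>R \<gamma>) = y"
    using assms unfolding matrix_vector_mult_scaleR by (simp add: scaleR_add_right)
  then show ?thesis
    using imp[of "\<alpha> *\<^sub>R y + X *v \<gamma>" "1 / \<alpha>" "(- 1 / \<alpha>) *\<^sub>R \<gamma>"] imp[of y \<alpha> \<gamma>] assms by auto
qed

text \<open>Scaling multiplies R b(y) + w by \<alpha> and \<Omega>^-1(y) by \<alpha>^-2, which cancels.\<close>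

lemma G_equivariant:
  assumes "\<alpha> \<noteq> 0"
  shows "G (\<alpha> *\<^sub>R y + X *v \<gamma>) (\<alpha> *\<^sub>R w) = G y (w + (1 / \<alpha>) *\<^sub>R (R *v \<gamma>))"
proof (cases "y \<in> Ns")
  case True
  then show ?thesis
    by (simp add: shifted_stat_def N_star_invariant[OF assms])
next
  case False
  then have y: "y \<notin> N" "det (\<Omega> y) \<noteq> 0"
    by (simp_all add: notin_N_star)
  have "R *v (\<alpha> *\<^sub>R b y + \<gamma>) + \<alpha> *\<^sub>R w = \<alpha> *\<^sub>R (R *v b y + (w + (1 / \<alpha>) *\<^sub>R (R *v \<gamma>)))"
    using assms by (simp add: matrix_vector_right_distrib matrix_vector_mult_scaleR algebra_simps)
  then show ?thesis
    using False assms y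
    by (simp add: shifted_stat_def N_star_invariant b_equivariant \<Omega>_equivariant matrix_inv_scaleR
        matrix_vector_mult_scaleR scaleR_matrix_vector_assoc[symmetric] power2_eq_square)
qed

lemma G_scale: "\<alpha> \<noteq> 0 \<Longrightarrow> G (\<alpha> *\<^sub>R y) (\<alpha> *\<^sub>R w) = G y w"
  using G_equivariant[of \<alpha> y 0 w] by simp

text \<open>All nuisance parameters of the mean and of the scale enter only through the shift R\<gamma>/\<alpha>.\<close>

lemma T_eq_G:
  assumes "R *v \<beta> = r" "\<alpha> \<noteq> 0"
  shows "T (X *v (\<beta> + \<gamma>) + \<alpha> *\<^sub>R y) = G y ((1 / \<alpha>) *\<^sub>R (R *v \<gamma>))"
proof -
  have "T (\<alpha> *\<^sub>R y + X *v (\<beta> + \<gamma>)) = G (\<alpha> *\<^sub>R y + X *v (\<beta> + \<gamma>)) (\<alpha> *\<^sub>R ((- 1 / \<alpha>) *\<^sub>R r))"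
    using assms(2) by (simp add: test_stat_eq_shifted_stat)
  also have "\<dots> = G y ((- 1 / \<alpha>) *\<^sub>R r + (1 / \<alpha>) *\<^sub>R (R *v (\<beta> + \<gamma>)))"
    by (rule G_equivariant[OF assms(2)])
  also have "\<dots> = G y ((1 / \<alpha>) *\<^sub>R (R *v \<gamma>))"
    using assms(1) by (simp add: matrix_vector_right_distrib scaleR_add_right)
  finally show ?thesis
    by (simp add: add.commute)
qed

text \<open>Condition (a) concerns the original statistic, hence a single shift. It extends to every shift, since
  y \<mapsto> G(y, w) is a translate of that statistic.\<close>

lemma G_translate:
  assumes "\<And>y. T (y + z) = T y"
  shows "G (y + z) w = G y w"
proof -
  obtain \<beta> \<gamma> where "R *v \<beta> = r" "R *v \<gamma> = w"
    using R_surj by metis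
  then have *: "G y w = T (X *v (\<beta> + \<gamma>) + y)" for y
    using T_eq_G[of \<beta> 1 \<gamma> y] by simp
  show ?thesis
    unfolding * using assms[of "X *v (\<beta> + \<gamma>) + y"] by (simp add: add.assoc)
qed

lemma open_compl_N_star: "open (- Ns)"
proof -
  have N: "open (- N)" and \<Omega>: "continuous_on (- N) \<Omega>"
    using pair by (simp_all add: regular_equivariant_pair_def open_Compl)
  have "continuous_on (- N) (\<lambda>y. det (\<Omega> y))"
    using \<Omega> unfolding continuous_on_def by (blast intro: tendsto_det)
  then have "\<forall>B. open B \<longrightarrow> open ((\<lambda>y. det (\<Omega> y)) -` B \<inter> - N)"
    using N by (simp add: continuous_on_open_vimage)
  then have "open ((\<lambda>y. det (\<Omega> y)) -` (- {0}) \<inter> - N)"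
    by (blast intro: open_Compl closed_singleton)
  also have "(\<lambda>y. det (\<Omega> y)) -` (- {0}) \<inter> - N = - Ns"
    by (auto simp: N_star_def)
  finally show ?thesis .
qed

lemma AE_notin_N_star: "AE y in lborel. y \<notin> Ns"
proof -
  have "AE y in lborel. y \<notin> N"
    by (rule AE_not_in) (use pair in \<open>simp add: regular_equivariant_pair_def\<close>)
  moreover have "AE y in lborel. y \<notin> N \<longrightarrow> det (\<Omega> y) \<noteq> 0"
    using pair by (simp add: regular_equivariant_pair_def invertible_det_nz)
  ultimately show ?thesis
    by eventually_elim (simp add: notin_N_star)
qed

lemma borel_N_star [measurable]: "Ns \<in> sets borel"
  using borel_open[OF open_compl_N_star] by (metis borel_comp double_complement)

lemma tendsto_b_\<Omega>:
  assumes f: "(f \<longlongrightarrow> y) F" and y: "y \<notin> Ns"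
  shows "((\<lambda>t. b (f t)) \<longlongrightarrow> b y) F" "((\<lambda>t. \<Omega> (f t)) \<longlongrightarrow> \<Omega> y) F"
proof -
  have N: "open (- N)" "y \<in> - N"
    using pair y by (simp_all add: regular_equivariant_pair_def open_Compl notin_N_star)
  then have "isCont b y" "isCont \<Omega> y"
    using pair by (auto simp: regular_equivariant_pair_def continuous_on_eq_continuous_at)
  then show "((\<lambda>t. b (f t)) \<longlongrightarrow> b y) F" "((\<lambda>t. \<Omega> (f t)) \<longlongrightarrow> \<Omega> y) F"
    using f by (auto intro: isCont_tendsto_compose)
qed

text \<open>Joint continuity. On the closed exceptional set, where the statistic is set to zero, continuity may
  fail; hence all limits below are taken at points outside of it.\<close>

lemma tendsto_G:
  assumes f: "(f \<longlongrightarrow> y) F" and g: "(g \<longlongrightarrow> w) F" and y: "y \<notin> Ns"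
  shows "((\<lambda>t. G (f t) (g t)) \<longlongrightarrow> G y w) F"
proof -
  have nz: "det (\<Omega> y) \<noteq> 0"
    using y by (simp add: notin_N_star)
  have "((\<lambda>t. (R *v b (f t) + g t) \<bullet> (matrix_inv (\<Omega> (f t)) *v (R *v b (f t) + g t))) \<longlongrightarrow> G y w) F"
    using y unfolding shifted_stat_def
    by (simp, intro tendsto_intros tendsto_b_\<Omega>[OF f y] g nz)
  moreover have "\<forall>\<^sub>F t in F. f t \<in> - Ns"
    using topological_tendstoD[OF f open_compl_N_star] y by simp
  then have "\<forall>\<^sub>F t in F. (R *v b (f t) + g t) \<bullet> (matrix_inv (\<Omega> (f t)) *v (R *v b (f t) + g t))
     = G (f t) (g t)"
    by eventually_elim (simp add: shifted_stat_def)
  ultimately show ?thesis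
    by (simp add: tendsto_cong)
qed

lemma continuous_on_G: "continuous_on (- Ns) (\<lambda>y. G y w)"
  unfolding continuous_on_def by (auto intro!: tendsto_G tendsto_ident_at tendsto_const)

lemma borel_measurable_G [measurable]: "(\<lambda>y. G y w) \<in> borel_measurable borel"
proof -
  have "(\<lambda>y. if y \<in> - Ns then G y w else 0) \<in> borel_measurable borel"
    using borel_open[OF open_compl_N_star] continuous_on_G
    by (intro borel_measurable_continuous_on_if) auto
  also have "(\<lambda>y. if y \<in> - Ns then G y w else 0) = (\<lambda>y. G y w)"
    by (auto simp: shifted_stat_def fun_eq_iff)
  finally show ?thesis .
qed

text \<open>The leading term of the shifted statistic as the shift tends to infinity in direction v.\<close>

definition inv_form :: "real^'n \<Rightarrow> real^'q \<Rightarrow> real" where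
  "inv_form y v = v \<bullet> (matrix_inv (\<Omega> y) *v v)"

text \<open>Moving y within y + span(X) changes R b(y) to any prescribed value and leaves
  \<Omega>(y) as it is. This yields points at which the statistic takes convenient values.\<close>

lemma G_recenter:
  assumes "y \<notin> Ns"
  shows "\<exists>y'. y' \<notin> Ns \<and> G y' w = inv_form y (v + w)"
proof -
  obtain \<gamma> where \<gamma>: "R *v \<gamma> = v"
    using R_surj by blast
  let ?y = "1 *\<^sub>R y + X *v (\<gamma> - b y)"
  have "G ?y (1 *\<^sub>R w) = G y (w + (1 / 1) *\<^sub>R (R *v (\<gamma> - b y)))"
    by (rule G_equivariant) simp
  also have "\<dots> = inv_form y (v + w)"
    using assms \<gamma> by (simp add: shifted_stat_def inv_form_def matrix_vector_mult_diff_distrib add.commute)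
  finally show ?thesis
    using assms N_star_invariant[of 1 y "\<gamma> - b y"] by (intro exI[of _ ?y]) simp
qed

lemma open_G_gt: "open {y. y \<notin> Ns \<and> G y w > C}"
  and open_G_lt: "open {y. y \<notin> Ns \<and> G y w < C}"
proof -
  have "open ((\<lambda>y. G y w) -` {C<..} \<inter> - Ns)" "open ((\<lambda>y. G y w) -` {..<C} \<inter> - Ns)"
    using continuous_on_G[of w] open_compl_N_star by (simp_all add: continuous_on_open_vimage)
  moreover have "(\<lambda>y. G y w) -` {C<..} \<inter> - Ns = {y. y \<notin> Ns \<and> G y w > C}"
    "(\<lambda>y. G y w) -` {..<C} \<inter> - Ns = {y. y \<notin> Ns \<and> G y w < C}"
    by auto
  ultimately show "open {y. y \<notin> Ns \<and> G y w > C}" "open {y. y \<notin> Ns \<and> G y w < C}"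
    by simp_all
qed

lemma borel_measurable_inv_form: "(\<lambda>y. if y \<in> Ns then 0 else inv_form y v) \<in> borel_measurable borel"
proof -
  have "continuous_on (- Ns) (\<lambda>y. inv_form y v)"
    unfolding continuous_on_def inv_form_def
    by (auto intro!: tendsto_inner tendsto_const tendsto_matrix_inv_mult tendsto_b_\<Omega>(2) tendsto_ident_at
        simp: notin_N_star)
  then have "(\<lambda>y. if y \<in> - Ns then inv_form y v else 0) \<in> borel_measurable borel"
    using borel_open[OF open_compl_N_star]
    by (intro borel_measurable_continuous_on_if) auto
  also have "(\<lambda>y. if y \<in> - Ns then inv_form y v else 0) = (\<lambda>y. if y \<in> Ns then 0 else inv_form y v)"
    by auto
  finally show ?thesis .
qed

lemma borel_inv_form_gt [measurable]: "{y. y \<notin> Ns \<and> inv_form y v > 0} \<in> sets borel"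
proof -
  note borel_measurable_inv_form[of v, measurable]
  have "{y. y \<notin> Ns \<and> inv_form y v > 0} = {y. (if y \<in> Ns then 0 else inv_form y v) > 0}"
    by auto
  also have "\<dots> \<in> sets borel"
    by measurable
  finally show ?thesis .
qed

lemma borel_inv_form_level [measurable]:
  "{y. y \<notin> Ns \<and> inv_form y v = 0} \<in> sets borel" "{y. y \<notin> Ns \<and> inv_form y v \<ge> 0} \<in> sets borel"
proof -
  note borel_measurable_inv_form[of v, measurable]
  have "{y. y \<notin> Ns \<and> inv_form y v = 0} = {y. (if y \<in> Ns then 0 else inv_form y v) = 0} - Ns"
    "{y. y \<notin> Ns \<and> inv_form y v \<ge> 0} = {y. (if y \<in> Ns then 0 else inv_form y v) \<ge> 0} - Ns"
    by auto
  then show "{y. y \<notin> Ns \<and> inv_form y v = 0} \<in> sets borel" "{y. y \<notin> Ns \<and> inv_form y v \<ge> 0} \<in> sets borel"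
    by simp_all
qed

text \<open>The two conditions on v' \<Omega>^-1 v \<ge> 0 and v' \<Omega>^-1 v > 0 differ by a null set only.\<close>

lemma inv_form_pos_of_nonneg:
  assumes null: "emeasure lborel {y. y \<notin> Ns \<and> inv_form y v = 0} = 0"
    and "emeasure lborel {y. y \<notin> Ns \<and> inv_form y v \<ge> 0} > 0"
  shows "emeasure lborel {y. y \<notin> Ns \<and> inv_form y v > 0} \<noteq> 0"
proof
  assume "emeasure lborel {y. y \<notin> Ns \<and> inv_form y v > 0} = 0"
  moreover have "{y. y \<notin> Ns \<and> inv_form y v \<ge> 0} = {y. y \<notin> Ns \<and> inv_form y v > 0} \<union> {y. y \<notin> Ns \<and> inv_form y v = 0}"
    by auto
  ultimately have "emeasure lborel {y. y \<notin> Ns \<and> inv_form y v \<ge> 0} \<le> 0"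
    using emeasure_subadditive[of "{y. y \<notin> Ns \<and> inv_form y v > 0}" lborel "{y. y \<notin> Ns \<and> inv_form y v = 0}"] null
    by (simp del: le_zero_eq)
  with assms(2) show False
    by simp
qed

lemma AE_inv_form_pos:
  assumes null: "emeasure lborel {y. y \<notin> Ns \<and> inv_form y v = 0} = 0"
    and nonneg: "AE y in lborel. y \<notin> N \<longrightarrow> nonneg_definite (\<Omega> y)"
  shows "AE y in lborel. y \<notin> Ns \<and> inv_form y v > 0"
proof -
  have "AE y in lborel. y \<notin> {y. y \<notin> Ns \<and> inv_form y v = 0}"
    using null by (intro AE_not_in) (simp add: null_sets_def)
  with nonneg AE_notin_N_star show ?thesis
  proof eventually_elim
    case (elim y)
    then have "inv_form y v \<ge> 0"
      unfolding inv_form_def by (intro nonneg_definite_inverse) (auto simp: notin_N_star)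
    with elim show ?case
      by auto
  qed
qed

section \<open>Limits of rejection probabilities\<close>

definition rej_prob :: "real^'n^'n \<Rightarrow> real^'q \<Rightarrow> real \<Rightarrow> real" where
  "rej_prob A w C = measure std {z. G (A *v z) w \<ge> C}"

lemma AE_std_notin_N_star:
  assumes "det A \<noteq> 0"
  shows "AE z in std. A *v z \<notin> Ns"
  using AE_notin_N_star AE_lborel_matrix_iff[OF assms, of "\<lambda>y. y \<notin> Ns"]
  by (simp add: AE_standard_gaussian_iff)

lemma ex_notin_N_star: "\<exists>y. y \<notin> Ns"
proof (rule ccontr)
  assume "\<not> ?thesis"
  then have "AE y in (lborel :: (real^'n) measure). False"
    using AE_notin_N_star by simp
  then show False
    using emeasure_lborel_open_nonzero[OF open_UNIV] by (simp add: AE_iff_measurable[OF _ refl])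
qed

lemma measurable_G_ge [measurable]: "{z. G (A *v z) w \<ge> C} \<in> sets borel"
  and measurable_G_lt [measurable]: "{z. G (A *v z) w < C} \<in> sets borel"
  by measurable

lemma measure_G_less: "measure std {z. G (A *v z) w < C} = 1 - rej_prob A w C"
proof -
  interpret prob_space std by (rule prob_space_standard_gaussian)
  have "{z. G (A *v z) w < C} = space std - {z. G (A *v z) w \<ge> C}"
    by auto
  moreover have "prob (space std - {z. G (A *v z) w \<ge> C}) = 1 - prob {z. G (A *v z) w \<ge> C}"
    by (rule prob_compl) simp
  ultimately show ?thesis
    by (simp only: rej_prob_def)
qed

context
  fixes A :: "nat \<Rightarrow> real^'n^'n" and A0 :: "real^'n^'n"
  assumes lim_A: "A \<longlonglongrightarrow> A0" and A0: "det A0 \<noteq> 0"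
begin

text \<open>The strict inequality describes an open event outside of the exceptional set, which is therefore
  inherited by all but finitely many members of the sequence.\<close>

lemma limit_rej_lower:
  assumes w: "ws \<longlonglongrightarrow> w" and le: "\<forall>\<^sub>F i in sequentially. rej_prob (A i) (ws i) C \<le> p"
  shows "measure std {z. A0 *v z \<in> {y. y \<notin> Ns \<and> G y w > C}} \<le> p"
proof (rule prob_le_of_AE_eventually[OF prob_space_standard_gaussian])
  show "AE z in std. z \<in> {z. A0 *v z \<in> {y. y \<notin> Ns \<and> G y w > C}} \<longrightarrow>
      (\<forall>\<^sub>F i in sequentially. z \<in> {z. G (A i *v z) (ws i) \<ge> C})"
  proof (intro AE_I2 impI)
    fix z assume "z \<in> {z. A0 *v z \<in> {y. y \<notin> Ns \<and> G y w > C}}"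
    then have z: "A0 *v z \<notin> Ns" "G (A0 *v z) w > C"
      by auto
    have "(\<lambda>i. G (A i *v z) (ws i)) \<longlonglongrightarrow> G (A0 *v z) w"
      by (intro tendsto_G tendsto_intros lim_A w z)
    then have "\<forall>\<^sub>F i in sequentially. G (A i *v z) (ws i) > C"
      using z(2) by (rule order_tendstoD)
    then show "\<forall>\<^sub>F i in sequentially. z \<in> {z. G (A i *v z) (ws i) \<ge> C}"
      by eventually_elim simp
  qed
qed (use le in \<open>simp_all add: rej_prob_def\<close>)

lemma tendsto_G_along:
  assumes w: "ws \<longlonglongrightarrow> w" and z: "A0 *v z \<notin> Ns"
  shows "(\<lambda>i. G (A i *v z) (ws i)) \<longlonglongrightarrow> G (A0 *v z) w"
  by (intro tendsto_G tendsto_matrix_vector_mult tendsto_const lim_A w z)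

lemma limit_rej_upper:
  assumes w: "ws \<longlonglongrightarrow> w" and le: "\<forall>\<^sub>F i in sequentially. rej_prob (A i) (ws i) C \<ge> 1 - p"
  shows "measure std {z. A0 *v z \<in> {y. y \<notin> Ns \<and> G y w < C}} \<le> p"
proof (rule prob_le_of_AE_eventually[OF prob_space_standard_gaussian])
  show "AE z in std. z \<in> {z. A0 *v z \<in> {y. y \<notin> Ns \<and> G y w < C}} \<longrightarrow>
      (\<forall>\<^sub>F i in sequentially. z \<in> {z. G (A i *v z) (ws i) < C})"
    using order_tendstoD(2)[OF tendsto_G_along[OF w]] by auto
  show "\<forall>\<^sub>F i in sequentially. measure std {z. G (A i *v z) (ws i) < C} \<le> p"
    using le by eventually_elim (simp add: measure_G_less)
qed simp_all

lemma limit_rej_tight: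
  assumes w: "ws \<longlonglongrightarrow> w" and Cs: "filterlim Cs at_top sequentially"
    and le: "\<forall>\<^sub>F i in sequentially. rej_prob (A i) (ws i) (Cs i) \<ge> \<delta>"
  shows "\<delta> \<le> 0"
proof -
  have "measure std UNIV \<le> 1 - \<delta>"
  proof (rule prob_le_of_AE_eventually[OF prob_space_standard_gaussian])
    have "\<forall>\<^sub>F i in sequentially. G (A i *v z) (ws i) < Cs i" if z: "A0 *v z \<notin> Ns" for z
    proof -
      have "\<forall>\<^sub>F i in sequentially. G (A i *v z) (ws i) < G (A0 *v z) w + 1"
        using tendsto_G_along[OF w z] by (rule order_tendstoD) simp
      moreover have "\<forall>\<^sub>F i in sequentially. Cs i > G (A0 *v z) w + 1"
        using Cs by (simp add: filterlim_at_top_dense)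
      ultimately show ?thesis
        by eventually_elim simp
    qed
    then show "AE z in std. z \<in> UNIV \<longrightarrow> (\<forall>\<^sub>F i in sequentially. z \<in> {z. G (A i *v z) (ws i) < Cs i})"
      using AE_std_notin_N_star[OF A0] by auto
    show "\<forall>\<^sub>F i in sequentially. measure std {z. G (A i *v z) (ws i) < Cs i} \<le> 1 - \<delta>"
      using le by eventually_elim (simp add: measure_G_less)
  qed simp_all
  then show ?thesis
    using prob_space.prob_space[of std, OF prob_space_standard_gaussian] by simp
qed

text \<open>Divide by the squared norm of the shift: the quotient converges to the form of the limiting direction,
  and where this is positive the statistic itself tends to infinity.\<close>

lemma limit_rej_unbounded:
  assumes u: "filterlim (\<lambda>i. norm (us i)) at_top sequentially"
    and v: "(\<lambda>i. (1 / norm (us i)) *\<^sub>R us i) \<longlonglongrightarrow> v"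
    and le: "\<forall>\<^sub>F i in sequentially. rej_prob (A i) (us i) C \<le> p"
  shows "measure std {z. A0 *v z \<in> {y. y \<notin> Ns \<and> inv_form y v > 0}} \<le> p"
proof (rule prob_le_of_AE_eventually[OF prob_space_standard_gaussian])
  have "\<forall>\<^sub>F i in sequentially. G (A i *v z) (us i) \<ge> C" if z: "A0 *v z \<notin> Ns" "inv_form (A0 *v z) v > 0" for z
  proof -
    define y where "y i = A i *v z" for i
    have y: "y \<longlonglongrightarrow> A0 *v z"
      unfolding y_def by (intro tendsto_matrix_vector_mult tendsto_const lim_A)
    define h where "h i = (1 / norm (us i)) *\<^sub>R (R *v b (y i)) + (1 / norm (us i)) *\<^sub>R us i" for i
    have "(\<lambda>i. 1 / norm (us i)) \<longlonglongrightarrow> 0"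
      using tendsto_inverse_0_at_top[OF u] by (simp add: inverse_eq_divide)
    then have "h \<longlonglongrightarrow> 0 *\<^sub>R (R *v b (A0 *v z)) + v"
      unfolding h_def
      by (intro tendsto_add tendsto_scaleR v tendsto_matrix_vector_mult tendsto_const tendsto_b_\<Omega>(1)[OF y z(1)])
    then have h: "h \<longlonglongrightarrow> v"
      by simp
    have lim: "(\<lambda>i. h i \<bullet> (matrix_inv (\<Omega> (y i)) *v h i)) \<longlonglongrightarrow> inv_form (A0 *v z) v"
      unfolding inv_form_def using z(1)
      by (intro tendsto_inner tendsto_matrix_inv_mult h tendsto_b_\<Omega>(2)[OF y z(1)]) (simp add: notin_N_star)
    have "filterlim (\<lambda>i. norm (us i) * norm (us i)) at_top sequentially"
      by (intro filterlim_at_top_mult_at_top u)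
    then have "filterlim (\<lambda>i. (h i \<bullet> (matrix_inv (\<Omega> (y i)) *v h i)) * (norm (us i) * norm (us i))) at_top sequentially"
      by (rule filterlim_tendsto_pos_mult_at_top[OF lim z(2)])
    then have "\<forall>\<^sub>F i in sequentially. C \<le> (h i \<bullet> (matrix_inv (\<Omega> (y i)) *v h i)) * (norm (us i) * norm (us i))"
      by (simp add: filterlim_at_top)
    moreover have "\<forall>\<^sub>F i in sequentially. y i \<in> - Ns"
      using topological_tendstoD[OF y open_compl_N_star] z(1) by simp
    moreover have "\<forall>\<^sub>F i in sequentially. 0 < norm (us i)"
      using u unfolding filterlim_at_top_dense by blast
    ultimately show ?thesis
    proof eventually_elim
      case (elim i)
      have "R *v b (y i) + us i = norm (us i) *\<^sub>R h i"
        using elim(3) by (simp add: h_def scaleR_add_right)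
      then have "G (y i) (us i) = (h i \<bullet> (matrix_inv (\<Omega> (y i)) *v h i)) * (norm (us i) * norm (us i))"
        using elim(2) by (simp add: shifted_stat_def matrix_vector_mult_scaleR)
      then show ?case
        using elim(1) by (simp add: y_def)
    qed
  qed
  then show "AE z in std. z \<in> {z. A0 *v z \<in> {y. y \<notin> Ns \<and> inv_form y v > 0}} \<longrightarrow>
      (\<forall>\<^sub>F i in sequentially. z \<in> {z. G (A i *v z) (us i) \<ge> C})"
    by auto
  show "{z. A0 *v z \<in> {y. y \<notin> Ns \<and> inv_form y v > 0}} \<in> sets std"
    using borel_vimage_matrix[OF borel_inv_form_gt] by simp
qed (use le in \<open>simp_all add: rej_prob_def\<close>)

end

section \<open>Renormalization\<close>

text \<open>Along the subsequence \<psi>, the matrix A (\<psi> i) may be replaced by A'_i, with an invertible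
  limit A_0, at the cost of stretching the shift by t_i. Regular limits are covered by t = 1.\<close>

definition renormalizes ::
  "(nat \<Rightarrow> real^'n^'n) \<Rightarrow> (nat \<Rightarrow> nat) \<Rightarrow> (nat \<Rightarrow> real^'n^'n) \<Rightarrow> real^'n^'n \<Rightarrow> (nat \<Rightarrow> real) \<Rightarrow> bool"
  where "renormalizes A \<psi> A' A0 t \<longleftrightarrow> strict_mono \<psi> \<and> A' \<longlonglongrightarrow> A0 \<and> det A0 \<noteq> 0 \<and> (\<forall>i. t i > 0) \<and>
    (\<forall>i z w. G (A (\<psi> i) *v z) w = G (A' i *v z) (t i *\<^sub>R w))"

lemma rej_renormalizes:
  "renormalizes A \<psi> A' A0 t \<Longrightarrow> rej_prob (A (\<psi> i)) w C = rej_prob (A' i) (t i *\<^sub>R w) C"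
  by (simp add: renormalizes_def rej_prob_def)

definition renormalizable :: "(real^'n^'n) set \<Rightarrow> bool" where
  "renormalizable \<AA> \<longleftrightarrow> (\<forall>A. (\<forall>m. A m \<in> \<AA>) \<longrightarrow> (\<exists>\<psi> A' A0 t. renormalizes A \<psi> A' A0 t))"

lemma renormalizes_singular:
  assumes "\<And>m. A m ** transpose (A m) = S m" "S \<longlonglongrightarrow> \<Sigma>'" "det \<Sigma>' = 0"
    and inv: "\<And>y z. z \<in> col_span \<Sigma>' \<Longrightarrow> T (y + z) = T y"
    and "strict_mono (\<phi> :: nat \<Rightarrow> nat)" "\<And>i. 0 < s (\<phi> i)"
    "(\<lambda>i. (1 / s (\<phi> i)) *\<^sub>R
       (orth_proj_matrix ((col_span \<Sigma>')\<^sup>\<bottom>) ** S (\<phi> i) ** orth_proj_matrix ((col_span \<Sigma>')\<^sup>\<bottom>)))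
       \<longlonglongrightarrow> D"
    "inj_on ((*v) D) ((col_span \<Sigma>')\<^sup>\<bottom>)"
  shows "\<exists>\<psi> A' A0 t. renormalizes A \<psi> A' A0 t \<and> filterlim t at_top sequentially"
proof -
  obtain \<psi> A' A0 t where *: "strict_mono (\<psi> :: nat \<Rightarrow> nat)" "A' \<longlonglongrightarrow> A0" "det A0 \<noteq> 0"
    "\<And>i. 0 < t i" "filterlim t at_top sequentially"
    "\<And>i z. t i *\<^sub>R (A (\<psi> i) *v z) - A' i *v z \<in> col_span \<Sigma>'"
    using renormalized_factors[OF assms(1-3,5-8)] by blast
  have "G (A (\<psi> i) *v z) w = G (A' i *v z) (t i *\<^sub>R w)" for i z w
  proof -
    have "G (A (\<psi> i) *v z) w = G (t i *\<^sub>R (A (\<psi> i) *v z)) (t i *\<^sub>R w)"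
      using *(4)[of i] by (simp add: G_scale)
    also have "\<dots> = G (A' i *v z + (t i *\<^sub>R (A (\<psi> i) *v z) - A' i *v z)) (t i *\<^sub>R w)"
      by simp
    also have "\<dots> = G (A' i *v z) (t i *\<^sub>R w)"
      by (rule G_translate[OF inv[OF *(6)]])
    finally show ?thesis .
  qed
  then have "renormalizes A \<psi> A' A0 t"
    using * by (simp add: renormalizes_def)
  with *(5) show ?thesis
    by blast
qed

lemma renormalizes_regular:
  assumes AS: "\<And>m. A m ** transpose (A m) = S m" and S: "S \<longlonglongrightarrow> \<Sigma>'" and nz: "det \<Sigma>' \<noteq> 0"
  shows "\<exists>\<psi> A' A0. renormalizes A \<psi> A' A0 (\<lambda>_. 1)"
proof -
  have "bounded (range A)"
    by (rule bounded_factors) (simp add: AS convergent_imp_bounded[OF S])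
  then obtain A0 \<psi> where \<psi>: "strict_mono (\<psi> :: nat \<Rightarrow> nat)" and A0: "(A \<circ> \<psi>) \<longlonglongrightarrow> A0"
    using bounded_imp_convergent_subsequence by blast
  have "(\<lambda>i. (A \<circ> \<psi>) i ** transpose ((A \<circ> \<psi>) i)) \<longlonglongrightarrow> A0 ** transpose A0"
    by (intro tendsto_matrix_mult tendsto_transpose A0)
  moreover have "(\<lambda>i. (A \<circ> \<psi>) i ** transpose ((A \<circ> \<psi>) i)) \<longlonglongrightarrow> \<Sigma>'"
    using LIMSEQ_subseq_LIMSEQ[OF S \<psi>] by (simp add: AS o_def)
  ultimately have "A0 ** transpose A0 = \<Sigma>'"
    by (rule LIMSEQ_unique)
  then have "det A0 \<noteq> 0"
    using nz by (auto simp: det_mul)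
  then have "renormalizes A \<psi> (A \<circ> \<psi>) A0 (\<lambda>_. 1)"
    using \<psi> A0 by (simp add: renormalizes_def)
  then show ?thesis
    by blast
qed

lemma renormalizes_subsequence:
  assumes "renormalizes (A \<circ> \<rho>) \<psi> A' A0 t" "strict_mono \<rho>"
  shows "renormalizes A (\<rho> \<circ> \<psi>) A' A0 t"
  using assms by (simp add: renormalizes_def strict_mono_o)

section \<open>Uniform bounds over renormalizable sets\<close>

text \<open>Points with b(y) = 0 have G(y, 0) = 0, so that the event G(y, 0) < C contains a nonempty open
  set.\<close>

lemma size_lt_1:
  assumes "renormalizable \<AA>" "C > 0"
  shows "\<exists>\<epsilon>>0. \<forall>A\<in>\<AA>. rej_prob A 0 C \<le> 1 - \<epsilon>"
proof (rule ccontr)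
  assume "\<not> ?thesis"
  then have "\<exists>A\<in>\<AA>. rej_prob A 0 C > 1 - 1 / real (Suc m)" for m
    by (metis linorder_not_le of_nat_0_less_iff zero_less_Suc zero_less_divide_1_iff)
  then obtain A where A: "\<And>m. A m \<in> \<AA>" "\<And>m. rej_prob (A m) 0 C > 1 - 1 / real (Suc m)"
    by metis
  obtain \<psi> A' A0 t where ren: "renormalizes A \<psi> A' A0 t"
    using assms(1) A(1) unfolding renormalizable_def by blast
  then have \<psi>: "strict_mono \<psi>" and A': "A' \<longlonglongrightarrow> A0" and A0: "det A0 \<noteq> 0"
    by (auto simp: renormalizes_def)
  have lim: "(\<lambda>i. 1 / real (Suc (\<psi> i))) \<longlonglongrightarrow> 0"
    using LIMSEQ_subseq_LIMSEQ[OF LIMSEQ_inverse_real_of_nat \<psi>] by (simp add: o_def inverse_eq_divide)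
  have "measure std {z. A0 *v z \<in> {y. y \<notin> Ns \<and> G y 0 < C}} \<le> p" if "p > 0" for p
  proof (rule limit_rej_upper[OF A' A0 tendsto_const])
    have "\<forall>\<^sub>F i in sequentially. 1 / real (Suc (\<psi> i)) < p"
      using lim \<open>p > 0\<close> by (rule order_tendstoD)
    then show "\<forall>\<^sub>F i in sequentially. 1 - p \<le> rej_prob (A' i) 0 C"
    proof eventually_elim
      case (elim i)
      have "rej_prob (A' i) 0 C = rej_prob (A (\<psi> i)) 0 C"
        using rej_renormalizes[OF ren, of i 0 C] by simp
      then show ?case
        using A(2)[of "\<psi> i"] elim by linarith
    qed
  qed
  then have "measure std {z. A0 *v z \<in> {y. y \<notin> Ns \<and> G y 0 < C}} \<le> 0"
    by (rule field_le_epsilon[of _ 0, simplified])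
  moreover have "{y. y \<notin> Ns \<and> G y 0 < C} \<noteq> {}"
  proof -
    obtain y where "y \<notin> Ns"
      using ex_notin_N_star by blast
    then obtain y' where "y' \<notin> Ns" "G y' 0 = inv_form y (0 + 0)"
      using G_recenter[of y 0 0] by blast
    then show ?thesis
      using assms(2) by (auto simp: inv_form_def)
  qed
  then have "measure std {z. A0 *v z \<in> {y. y \<notin> Ns \<and> G y 0 < C}} > 0"
    by (intro measure_std_pos[OF A0] emeasure_lborel_open_nonzero open_G_lt)
  ultimately show False
    by simp
qed

text \<open>The limit statistic is finite almost surely, so it cannot exceed critical values tending to infinity.\<close>

lemma size_tight:
  assumes "renormalizable \<AA>" "\<delta> > 0"
  shows "\<exists>C>0. \<forall>A\<in>\<AA>. rej_prob A 0 C \<le> \<delta>"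
proof (rule ccontr)
  assume "\<not> ?thesis"
  then have "\<exists>A\<in>\<AA>. rej_prob A 0 (real (Suc m)) > \<delta>" for m
    by (metis linorder_not_le of_nat_0_less_iff zero_less_Suc)
  then obtain A where A: "\<And>m. A m \<in> \<AA>" "\<And>m. rej_prob (A m) 0 (real (Suc m)) > \<delta>"
    by metis
  obtain \<psi> A' A0 t where ren: "renormalizes A \<psi> A' A0 t"
    using assms(1) A(1) unfolding renormalizable_def by blast
  then have \<psi>: "strict_mono \<psi>" and A': "A' \<longlonglongrightarrow> A0" and A0: "det A0 \<noteq> 0"
    by (auto simp: renormalizes_def)
  have "\<delta> \<le> 0"
  proof (rule limit_rej_tight[OF A' A0 tendsto_const])
    have "filterlim (\<lambda>i. real (Suc i)) at_top sequentially"
      using filterlim_compose[OF filterlim_real_sequentially filterlim_Suc] .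
    then show "filterlim (\<lambda>i. real (Suc (\<psi> i))) at_top sequentially"
      by (rule filterlim_compose[OF _ filterlim_subseq[OF \<psi>]])
    have "\<delta> \<le> rej_prob (A' i) 0 (real (Suc (\<psi> i)))" for i
      using rej_renormalizes[OF ren, of i 0 "real (Suc (\<psi> i))"] A(2)[of "\<psi> i"]
      by (simp only: scaleR_zero_right less_imp_le)
    then show "\<forall>\<^sub>F i in sequentially. \<delta> \<le> rej_prob (A' i) 0 (real (Suc (\<psi> i)))"
      by (intro always_eventually allI)
  qed
  with assms(2) show False
    by simp
qed

lemma open_G_gt_nonempty:
  assumes "v \<noteq> 0" "y \<notin> Ns" "inv_form y v > 0"
  shows "{y. y \<notin> Ns \<and> G y w > C} \<noteq> {}"
proof -
  obtain s where "(s *\<^sub>R v + w) \<bullet> (matrix_inv (\<Omega> y) *v (s *\<^sub>R v + w)) > C"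
    using quadratic_form_unbounded assms(3) unfolding inv_form_def by blast
  then show ?thesis
    using G_recenter[OF assms(2), of w "s *\<^sub>R v"] by (auto simp: inv_form_def)
qed

text \<open>The shifts of a minimizing sequence, after renormalization, either converge or escape to infinity.
  In the first case the limiting event is a nonempty open set, by the existence of some v and y with a
  positive form; in the second case the assumption on all directions applies. The set W = {0}
  excludes the second case and yields the bound under the null hypothesis.\<close>

lemma rej_bounded_below:
  assumes "renormalizable \<AA>"
    and vy: "v \<noteq> 0" "y \<notin> Ns" "inv_form y v > 0"
    and dir: "W = {0} \<or> (\<forall>v. norm v = 1 \<longrightarrow> emeasure lborel {y. y \<notin> Ns \<and> inv_form y v > 0} \<noteq> 0)"
  shows "\<exists>\<epsilon>>0. \<forall>A\<in>\<AA>. \<forall>w\<in>W. rej_prob A w C \<ge> \<epsilon>"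
proof (rule ccontr)
  assume "\<not> ?thesis"
  then have "\<exists>A\<in>\<AA>. \<exists>w\<in>W. rej_prob A w C < 1 / real (Suc m)" for m
    by (metis linorder_not_le of_nat_0_less_iff zero_less_Suc zero_less_divide_1_iff)
  then obtain A w where A: "\<And>m. A m \<in> \<AA>" "\<And>m. w m \<in> W" "\<And>m. rej_prob (A m) (w m) C < 1 / real (Suc m)"
    by metis
  obtain \<psi> A' A0 t where ren: "renormalizes A \<psi> A' A0 t"
    using assms(1) A(1) unfolding renormalizable_def by blast
  then have \<psi>: "strict_mono \<psi>" and A': "A' \<longlonglongrightarrow> A0" and A0: "det A0 \<noteq> 0"
    by (auto simp: renormalizes_def)
  define u where "u i = t i *\<^sub>R w (\<psi> i)" for i
  have rej_prob: "rej_prob (A' i) (u i) C < 1 / real (Suc (\<psi> i))" for i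
    using A(3)[of "\<psi> i"] by (simp add: u_def rej_renormalizes[OF ren])
  have ev: "\<forall>\<^sub>F i in sequentially. rej_prob (A' (\<rho> i)) (u (\<rho> i)) C \<le> p" if "p > 0" "strict_mono \<rho>" for p \<rho>
  proof -
    have "(\<lambda>i. 1 / real (Suc ((\<psi> \<circ> \<rho>) i))) \<longlonglongrightarrow> 0"
      using LIMSEQ_subseq_LIMSEQ[OF LIMSEQ_inverse_real_of_nat strict_mono_o[OF \<psi> that(2)]]
      by (simp add: o_def inverse_eq_divide)
    then have "\<forall>\<^sub>F i in sequentially. 1 / real (Suc ((\<psi> \<circ> \<rho>) i)) < p"
      using that(1) by (rule order_tendstoD)
    then show ?thesis
    proof eventually_elim
      case (elim i)
      then show ?case
        using rej_prob[of "\<rho> i"] by simp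
    qed
  qed
  show False
  proof (rule compactify_sequence[of u])
    fix \<rho> w0 assume \<rho>: "strict_mono (\<rho> :: nat \<Rightarrow> nat)" and w0: "(\<lambda>i. u (\<rho> i)) \<longlonglongrightarrow> w0"
    have "measure std {z. A0 *v z \<in> {y. y \<notin> Ns \<and> G y w0 > C}} \<le> p" if "p > 0" for p
      by (rule limit_rej_lower[where C=C, OF LIMSEQ_subseq_LIMSEQ[OF A' \<rho>] A0 w0]) (simp add: ev[OF that \<rho>])
    then have "measure std {z. A0 *v z \<in> {y. y \<notin> Ns \<and> G y w0 > C}} \<le> 0"
      by (rule field_le_epsilon[of _ 0, simplified])
    moreover have "measure std {z. A0 *v z \<in> {y. y \<notin> Ns \<and> G y w0 > C}} > 0"
      by (intro measure_std_pos[OF A0] emeasure_lborel_open_nonzero open_G_gt open_G_gt_nonempty[OF vy])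
    ultimately show False
      by simp
  next
    fix \<rho> v0 assume \<rho>: "strict_mono (\<rho> :: nat \<Rightarrow> nat)"
      and inf: "filterlim (\<lambda>i. norm (u (\<rho> i))) at_top sequentially"
      and v0: "norm v0 = 1" "(\<lambda>i. (1 / norm (u (\<rho> i))) *\<^sub>R u (\<rho> i)) \<longlonglongrightarrow> v0"
    have "W \<noteq> {0}"
    proof
      assume "W = {0}"
      then have "u i = 0" for i
        using A(2) by (simp add: u_def)
      then show False
        using inf by (simp add: filterlim_at_top_dense) (metis less_irrefl)
    qed
    then have pos: "emeasure lborel {y. y \<notin> Ns \<and> inv_form y v0 > 0} \<noteq> 0"
      using dir v0(1) by blast
    have "measure std {z. A0 *v z \<in> {y. y \<notin> Ns \<and> inv_form y v0 > 0}} \<le> p" if "p > 0" for p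
      by (rule limit_rej_unbounded[where C=C, OF LIMSEQ_subseq_LIMSEQ[OF A' \<rho>] A0 inf v0(2)]) (simp add: ev[OF that \<rho>])
    then have "measure std {z. A0 *v z \<in> {y. y \<notin> Ns \<and> inv_form y v0 > 0}} \<le> 0"
      by (rule field_le_epsilon[of _ 0, simplified])
    then show False
      using measure_std_pos[OF A0 pos] by simp
  qed
qed

text \<open>The bound l on the shifts tends to infinity after renormalization. A sequence of counterexamples
  would then have a limiting direction in which rejection is almost sure. The hypothesis speaks of
  subsequences of subsequences, as usual for the proof of convergence of the whole sequence.\<close>

lemma rej_tendsto_1:
  assumes pos: "\<And>v. v \<noteq> 0 \<Longrightarrow> AE y in lborel. y \<notin> Ns \<and> inv_form y v > 0"
    and ren: "\<And>\<rho> :: nat \<Rightarrow> nat. strict_mono \<rho> \<Longrightarrow>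
      \<exists>\<psi> A' A0 t. renormalizes (A \<circ> \<rho>) \<psi> A' A0 t \<and> filterlim (\<lambda>i. t i * l (\<rho> (\<psi> i))) at_top sequentially"
    and "\<epsilon> > 0"
  shows "\<forall>\<^sub>F m in sequentially. \<forall>w. norm w \<ge> l m \<longrightarrow> rej_prob (A m) w C \<ge> 1 - \<epsilon>"
proof (rule ccontr)
  define bad where "bad m \<longleftrightarrow> (\<exists>w. norm w \<ge> l m \<and> rej_prob (A m) w C < 1 - \<epsilon>)" for m
  assume "\<not> ?thesis"
  then have "\<exists>\<^sub>F m in sequentially. bad m"
    by (simp add: frequently_def bad_def not_less)
  then have inf: "infinite {m. bad m}"
    by (simp add: cofinite_eq_sequentially[symmetric] frequently_cofinite)
  obtain \<rho> :: "nat \<Rightarrow> nat" where \<rho>: "strict_mono \<rho>" "\<And>i. bad (\<rho> i)"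
    using infinite_enumerate[OF inf] by auto
  then obtain w where w: "\<And>i. norm (w i) \<ge> l (\<rho> i)" "\<And>i. rej_prob (A (\<rho> i)) (w i) C < 1 - \<epsilon>"
    unfolding bad_def by metis
  obtain \<psi> A' A0 t where R: "renormalizes (A \<circ> \<rho>) \<psi> A' A0 t"
    and t: "filterlim (\<lambda>i. t i * l (\<rho> (\<psi> i))) at_top sequentially"
    using ren[OF \<rho>(1)] by blast
  then have A': "A' \<longlonglongrightarrow> A0" and A0: "det A0 \<noteq> 0" and tpos: "\<And>i. t i > 0"
    by (auto simp: renormalizes_def)
  define u where "u i = t i *\<^sub>R w (\<psi> i)" for i
  have u_inf: "filterlim (\<lambda>i. norm (u i)) at_top sequentially"
    using tpos w(1) by (intro filterlim_at_top_mono[OF t] always_eventually)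
      (simp add: u_def mult_left_mono less_imp_le)
  have rej_prob: "rej_prob (A' i) (u i) C \<le> 1 - \<epsilon>" for i
    using rej_renormalizes[OF R, of i "w (\<psi> i)" C] w(2)[of "\<psi> i"] by (simp add: u_def)
  show False
  proof (rule compactify_sequence[of u])
    fix \<sigma> w0 assume \<sigma>: "strict_mono (\<sigma> :: nat \<Rightarrow> nat)" and w0: "(\<lambda>i. u (\<sigma> i)) \<longlonglongrightarrow> w0"
    have "filterlim (\<lambda>i. norm (u (\<sigma> i))) at_top sequentially"
      by (rule filterlim_compose[OF u_inf filterlim_subseq[OF \<sigma>]])
    then show False
      using tendsto_norm[OF w0] not_tendsto_and_filterlim_at_infinity filterlim_at_top_imp_at_infinity
        trivial_limit_sequentially by blast
  next
    fix \<sigma> v assume \<sigma>: "strict_mono (\<sigma> :: nat \<Rightarrow> nat)"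
      and inf: "filterlim (\<lambda>i. norm (u (\<sigma> i))) at_top sequentially"
      and v: "norm v = 1" "(\<lambda>i. (1 / norm (u (\<sigma> i))) *\<^sub>R u (\<sigma> i)) \<longlonglongrightarrow> v"
    interpret prob_space std by (rule prob_space_standard_gaussian)
    have "measure std {z. A0 *v z \<in> {y. y \<notin> Ns \<and> inv_form y v > 0}} \<le> 1 - \<epsilon>"
      by (rule limit_rej_unbounded[where C=C, OF LIMSEQ_subseq_LIMSEQ[OF A' \<sigma>] A0 inf v(2)]) (simp add: rej_prob)
    moreover have "measure std {z. A0 *v z \<in> {y. y \<notin> Ns \<and> inv_form y v > 0}} = 1"
    proof -
      have "v \<noteq> 0"
        using v(1) by auto
      then have "AE y in lborel. y \<in> {y. y \<notin> Ns \<and> inv_form y v > 0}"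
        unfolding mem_Collect_eq by (rule pos)
      moreover have "Measurable.pred borel (\<lambda>y. y \<in> {y. y \<notin> Ns \<and> inv_form y v > 0})"
        by measurable
      ultimately have "AE z in std. A0 *v z \<in> {y. y \<notin> Ns \<and> inv_form y v > 0}"
        unfolding AE_standard_gaussian_iff using AE_lborel_matrix_iff[OF A0] by blast
      then show ?thesis
        by (subst prob_eq_1) (use borel_vimage_matrix[OF borel_inv_form_gt] in simp_all)
    qed
    ultimately show False
      using \<open>\<epsilon> > 0\<close> by simp
  qed
qed

section \<open>Means and rejection probabilities\<close>

lemma rejection_probability:
  assumes \<beta>: "R *v \<beta> = r" and \<sigma>2: "\<sigma>2 > 0" and A: "det A \<noteq> 0"
  shows "measure (gaussian (X *v (\<beta> + \<gamma>)) (\<sigma>2 *\<^sub>R (A ** transpose A))) (rejection_region R r N b \<Omega> C)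
     = rej_prob A ((1 / sqrt \<sigma>2) *\<^sub>R (R *v \<gamma>)) C"
proof -
  let ?B = "sqrt \<sigma>2 *\<^sub>R A" and ?\<mu> = "X *v (\<beta> + \<gamma>)"
  have sq: "sqrt \<sigma>2 \<noteq> 0"
    using \<sigma>2 by simp
  have "\<sigma>2 *\<^sub>R (A ** transpose A) = ?B ** transpose ?B"
    using \<sigma>2 by (simp add: transpose_scalar matrix_mult_scaleR)
  moreover have "det ?B \<noteq> 0"
    using A sq by (simp add: det_scaleR_nonzero_iff)
  ultimately have gauss: "gaussian ?\<mu> (\<sigma>2 *\<^sub>R (A ** transpose A)) = distr std borel (\<lambda>z. ?\<mu> + ?B *v z)"
    by (simp add: gaussian_eq_distr)
  have W: "rejection_region R r N b \<Omega> C = {y. G y (- r) \<ge> C}"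
    by (simp add: rejection_region_def test_stat_eq_shifted_stat)
  have [measurable]: "rejection_region R r N b \<Omega> C \<in> sets borel"
    unfolding W by measurable
  have "(\<lambda>z. ?\<mu> + ?B *v z) -` rejection_region R r N b \<Omega> C = {z. G (A *v z) ((1 / sqrt \<sigma>2) *\<^sub>R (R *v \<gamma>)) \<ge> C}"
    using T_eq_G[OF \<beta> sq, of \<gamma>] by (auto simp: rejection_region_def scaleR_matrix_vector_assoc[symmetric])
  moreover have "(\<lambda>z. ?\<mu> + ?B *v z) \<in> measurable std borel"
    by measurable
  ultimately show ?thesis
    by (simp add: gauss rej_prob_def measure_distr)
qed

lemma mean_decomposition:
  assumes "\<mu> \<in> col_span X"
  obtains \<beta> \<gamma> where "R *v \<beta> = r" "\<mu> = X *v (\<beta> + \<gamma>)"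
proof -
  obtain \<delta> where "\<mu> = X *v \<delta>"
    using assms by (auto simp: mem_col_span_iff)
  moreover obtain \<beta> where "R *v \<beta> = r"
    using R_surj by blast
  ultimately show thesis
    using that[of \<beta> "\<delta> - \<beta>"] by simp
qed

lemma null_mean_shift:
  assumes "R *v \<beta> = r" "R *v \<gamma> = 0"
  shows "X *v (\<beta> + \<gamma>) \<in> null_means X R r"
proof -
  have "R *v (\<beta> + \<gamma>) = r"
    using assms by (simp add: matrix_vector_right_distrib)
  then show ?thesis
    unfolding null_means_def by blast
qed

lemma null_means_nonempty: "null_means X R r \<noteq> {}"
  using R_surj[of r] by (auto simp: null_means_def)

text \<open>A linear right inverse of R provides a point of the null hypothesis at distance at most
  K * norm (R\<gamma>).\<close>

lemma infdist_null_means_le: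
  "\<exists>K>0. \<forall>\<beta> \<gamma>. R *v \<beta> = r \<longrightarrow> infdist (X *v (\<beta> + \<gamma>)) (null_means X R r) \<le> K * norm (R *v \<gamma>)"
proof -
  obtain g where g: "linear g" "\<And>w. R *v g w = w"
    using linear_surjective_right_inverse[of "(*v) R"] R_surj by (auto simp: fun_eq_iff surj_def) metis
  have "linear (\<lambda>w. X *v g w)"
    using linear_compose[OF g(1) matrix_vector_mul_linear[of X]] by (simp add: o_def)
  then obtain K where K: "K > 0" "\<And>w. norm (X *v g w) \<le> K * norm w"
    using linear_bounded_pos by blast
  have "infdist (X *v (\<beta> + \<gamma>)) (null_means X R r) \<le> K * norm (R *v \<gamma>)" if "R *v \<beta> = r" for \<beta> \<gamma>
  proof -
    have "X *v (\<beta> + (\<gamma> - g (R *v \<gamma>))) \<in> null_means X R r"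
      using that by (intro null_mean_shift) (simp_all add: matrix_vector_mult_diff_distrib g)
    then have "infdist (X *v (\<beta> + \<gamma>)) (null_means X R r)
        \<le> dist (X *v (\<beta> + \<gamma>)) (X *v (\<beta> + (\<gamma> - g (R *v \<gamma>))))"
      by (rule infdist_le)
    also have "\<dots> = norm (X *v g (R *v \<gamma>))"
      by (simp add: dist_norm matrix_vector_right_distrib matrix_vector_mult_diff_distrib)
    also have "\<dots> \<le> K * norm (R *v \<gamma>)"
      by (rule K)
    finally show ?thesis .
  qed
  with K(1) show ?thesis
    by blast
qed

text \<open>Conversely, X is injective, so that R\<gamma> is a linear function of the difference of the means.\<close>

lemma infdist_null_means_ge:
  assumes X: "rank X = CARD('k)"
  shows "\<exists>K>0. \<forall>\<beta> \<gamma>. R *v \<beta> = r \<longrightarrow> norm (R *v \<gamma>) \<le> K * infdist (X *v (\<beta> + \<gamma>)) (null_means X R r)"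
proof -
  have "inj ((*v) X)"
    using X by (simp add: full_rank_injective)
  then obtain h where h: "linear h" "\<And>x. h (X *v x) = x"
    using linear_injective_left_inverse[of "(*v) X"] by (auto simp: fun_eq_iff)
  have "linear (\<lambda>y. R *v h y)"
    using linear_compose[OF h(1) matrix_vector_mul_linear[of R]] by (simp add: o_def)
  then obtain K where K: "K > 0" "\<And>y. norm (R *v h y) \<le> K * norm y"
    using linear_bounded_pos by blast
  have "norm (R *v \<gamma>) \<le> K * infdist (X *v (\<beta> + \<gamma>)) (null_means X R r)" if \<beta>: "R *v \<beta> = r" for \<beta> \<gamma>
  proof -
    have "norm (R *v \<gamma>) / K \<le> (INF a\<in>null_means X R r. dist (X *v (\<beta> + \<gamma>)) a)"
    proof (rule cINF_greatest[OF null_means_nonempty])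
      fix a assume "a \<in> null_means X R r"
      then obtain \<delta> where \<delta>: "a = X *v \<delta>" "R *v \<delta> = r"
        by (auto simp: null_means_def)
      have "R *v h (X *v (\<beta> + \<gamma>) - a) = R *v \<gamma>"
        using \<beta> \<delta> by (simp add: h flip: matrix_vector_mult_diff_distrib)
          (simp add: matrix_vector_mult_diff_distrib matrix_vector_right_distrib)
      then show "norm (R *v \<gamma>) / K \<le> dist (X *v (\<beta> + \<gamma>)) a"
        using K(1) K(2)[of "X *v (\<beta> + \<gamma>) - a"] by (simp add: dist_norm divide_le_eq mult.commute)
    qed
    then show ?thesis
      using K(1) null_means_nonempty by (simp add: infdist_def divide_le_eq mult.commute)
  qed
  with K(1) show ?thesis
    by blast
qed

text \<open>The sets over which the infima in the third item are taken are nonempty.\<close>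

lemma far_alternative:
  assumes X: "rank X = CARD('k)"
  shows "\<exists>\<mu> \<in> alt_means X R r. infdist \<mu> (null_means X R r) \<ge> a"
proof -
  obtain K where K: "K > 0"
    "\<And>\<beta> \<gamma>. R *v \<beta> = r \<Longrightarrow> norm (R *v \<gamma>) \<le> K * infdist (X *v (\<beta> + \<gamma>)) (null_means X R r)"
    using infdist_null_means_ge[OF X] by blast
  obtain w :: "real^'q" where w: "norm w = K * (\<bar>a\<bar> + 1)"
    using vector_choose_size[of "K * (\<bar>a\<bar> + 1)"] K(1) by auto
  obtain \<beta> \<gamma> where \<beta>: "R *v \<beta> = r" and \<gamma>: "R *v \<gamma> = w"
    using R_surj by metis
  let ?\<mu> = "X *v (\<beta> + \<gamma>)"
  have "K * (\<bar>a\<bar> + 1) \<le> K * infdist ?\<mu> (null_means X R r)"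
    using K(2)[OF \<beta>, of \<gamma>] by (simp add: \<gamma> w)
  then have far: "\<bar>a\<bar> + 1 \<le> infdist ?\<mu> (null_means X R r)"
    using K(1) by simp
  then have "?\<mu> \<notin> null_means X R r"
    by auto
  then have "?\<mu> \<in> alt_means X R r"
    by (simp add: alt_means_def matrix_vector_mult_in_col_span)
  then show ?thesis
    using far by (intro bexI[of _ ?\<mu>]) auto
qed

end

section \<open>Size and power of the test\<close>

theorem theorem5p21:
  fixes X :: "real^'k^'n" and R :: "real^'k^'q" and r :: "real^'q"
    and \<CC> :: "(real^'n^'n) set"
    and N :: "(real^'n) set"
    and b :: "real^'n \<Rightarrow> real^'k" and \<Omega> :: "real^'n \<Rightarrow> real^'q^'q"
  defines "M0 \<equiv> null_means X R r" and "M1 \<equiv> alt_means X R r"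
    and "Ns \<equiv> N_star N \<Omega>" and "T \<equiv> test_stat R r N b \<Omega>"
    and "W \<equiv> rejection_region R r N b \<Omega>"
    and "P \<equiv> (\<lambda>\<mu> \<Phi>. measure (gaussian \<mu> \<Phi>))"
  assumes "CARD('k) < CARD('n)"
    and "rank X = CARD('k)" and "rank R = CARD('q)"
    and "covariance_model \<CC>"
    and "regular_equivariant_pair X N b \<Omega>"
    and "\<exists>v y. v \<noteq> 0 \<and> y \<notin> Ns \<and> v \<bullet> (matrix_inv (\<Omega> y) *v v) > 0"
    and "\<forall>v. v \<noteq> 0 \<longrightarrow>
           emeasure lborel {y. y \<notin> Ns \<and> v \<bullet> (matrix_inv (\<Omega> y) *v v) = 0} = 0"
    and "bounded \<CC>"
  shows
    "((\<forall>y. \<forall>z\<in>sing_limit_union \<CC>. T (y + z) = T y) \<and>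
      (\<forall>S \<Sigma>'. (\<forall>m. S m \<in> \<CC>) \<and> S \<longlonglongrightarrow> \<Sigma>' \<and> det \<Sigma>' = 0 \<longrightarrow>
         (\<exists>\<phi> s D. strict_mono (\<phi> :: nat \<Rightarrow> nat) \<and> (\<forall>i. 0 < s (\<phi> i)) \<and>
            (\<lambda>i. (1 / s (\<phi> i)) *\<^sub>R
                 (orth_proj_matrix (orthogonal_comp (col_span \<Sigma>')) ** S (\<phi> i) **
                  orth_proj_matrix (orthogonal_comp (col_span \<Sigma>')))) \<longlonglongrightarrow> D \<and>
            inj_on (\<lambda>x. D *v x) (orthogonal_comp (col_span \<Sigma>'))))
      \<longrightarrow>
      \<comment> \<open>item 1\<close>
      (\<forall>C>0.
         (SUP \<mu>\<in>M0. SUP \<sigma>2\<in>{0<..}. SUP \<Sigma>\<in>\<CC>. P \<mu> (\<sigma>2 *\<^sub>R \<Sigma>) (W C)) < 1 \<and>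
         (INF \<mu>\<in>M0. INF \<sigma>2\<in>{0<..}. INF \<Sigma>\<in>\<CC>. P \<mu> (\<sigma>2 *\<^sub>R \<Sigma>) (W C)) > 0) \<and>
      \<comment> \<open>item 2\<close>
      ((\<forall>v. norm v = 1 \<longrightarrow>
          emeasure lborel {y. y \<notin> Ns \<and> v \<bullet> (matrix_inv (\<Omega> y) *v v) \<ge> 0} > 0) \<longrightarrow>
       (\<forall>C>0. (INF \<mu>\<in>M1. INF \<sigma>2\<in>{0<..}. INF \<Sigma>\<in>\<CC>. P \<mu> (\<sigma>2 *\<^sub>R \<Sigma>) (W C)) > 0)) \<and>
      \<comment> \<open>item 3, first statement\<close>
      ((AE y in lborel. y \<notin> N \<longrightarrow> nonneg_definite (\<Omega> y)) \<longrightarrow>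
       (\<forall>C>0. \<forall>c>0. \<forall>S \<Sigma>'. (\<forall>m. S m \<in> \<CC>) \<and> S \<longlonglongrightarrow> \<Sigma>' \<and> det \<Sigma>' = 0 \<longrightarrow>
          (\<lambda>m. INF (\<mu>, \<sigma>2) \<in> {(\<mu>, \<sigma>2). \<mu> \<in> M1 \<and> 0 < \<sigma>2 \<and> infdist \<mu> M0 / sqrt \<sigma>2 \<ge> c}.
                 P \<mu> (\<sigma>2 *\<^sub>R S m) (W C)) \<longlonglongrightarrow> 1)) \<and>
      \<comment> \<open>item 4\<close>
      (\<forall>\<delta>. 0 < \<delta> \<and> \<delta> < 1 \<longrightarrow>
         (\<exists>C>0. (SUP \<mu>\<in>M0. SUP \<sigma>2\<in>{0<..}. SUP \<Sigma>\<in>\<CC>. P \<mu> (\<sigma>2 *\<^sub>R \<Sigma>) (W C)) \<le> \<delta>)))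
     \<and>
     \<comment> \<open>item 3, second statement, which requires neither (a) nor (b)\<close>
     ((AE y in lborel. y \<notin> N \<longrightarrow> nonneg_definite (\<Omega> y)) \<longrightarrow>
      (\<forall>C>0. \<forall>c \<sigma>2 S \<Sigma>'.
         (\<forall>m. 0 < c m) \<and> (\<forall>m. 0 < \<sigma>2 m) \<and>
         filterlim (\<lambda>m. c m / sqrt (\<sigma>2 m)) at_top sequentially \<and>
         (\<forall>m. S m \<in> \<CC>) \<and> S \<longlonglongrightarrow> \<Sigma>' \<and> pos_definite \<Sigma>' \<longrightarrow>
         (\<lambda>m. INF \<mu> \<in> {\<mu>. \<mu> \<in> M1 \<and> infdist \<mu> M0 \<ge> c m}.
                P \<mu> (\<sigma>2 m *\<^sub>R S m) (W C)) \<longlonglongrightarrow> 1))"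
proof -
  interpret E: equivariant_test X R r N b \<Omega>
    using assms by unfold_locales auto
  let ?a = "\<forall>y. \<forall>z\<in>sing_limit_union \<CC>. T (y + z) = T y"
  let ?b = "\<forall>S \<Sigma>'. (\<forall>m. S m \<in> \<CC>) \<and> S \<longlonglongrightarrow> \<Sigma>' \<and> det \<Sigma>' = 0 \<longrightarrow>
         (\<exists>\<phi> s D. strict_mono (\<phi> :: nat \<Rightarrow> nat) \<and> (\<forall>i. 0 < s (\<phi> i)) \<and>
            (\<lambda>i. (1 / s (\<phi> i)) *\<^sub>R
                 (orth_proj_matrix (orthogonal_comp (col_span \<Sigma>')) ** S (\<phi> i) **
                  orth_proj_matrix (orthogonal_comp (col_span \<Sigma>')))) \<longlonglongrightarrow> D \<and>
            inj_on (\<lambda>x. D *v x) (orthogonal_comp (col_span \<Sigma>')))"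
  have rank_X: "rank X = CARD('k)"
    by fact
  have CC: "\<CC> \<noteq> {}" "\<And>\<Sigma>. \<Sigma> \<in> \<CC> \<Longrightarrow> pos_definite \<Sigma>"
    using \<open>covariance_model \<CC>\<close> by (auto simp: covariance_model_def)
  have "\<exists>A. A ** transpose A = \<Sigma> \<and> det A \<noteq> 0" if "\<Sigma> \<in> \<CC>" for \<Sigma>
    using pos_definite_factorization[OF CC(2)[OF that]] by metis
  then obtain F where F: "\<And>\<Sigma>. \<Sigma> \<in> \<CC> \<Longrightarrow> F \<Sigma> ** transpose (F \<Sigma>) = \<Sigma>" "\<And>\<Sigma>. \<Sigma> \<in> \<CC> \<Longrightarrow> det (F \<Sigma>) \<noteq> 0"
    by metis
  have null_H: "emeasure lborel {y. y \<notin> E.Ns \<and> E.inv_form y v = 0} = 0" if "v \<noteq> 0" for v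
    using assms(13) that by (simp add: E.inv_form_def Ns_def)
  obtain v0 y0 where v0: "v0 \<noteq> 0" "y0 \<notin> E.Ns" "E.inv_form y0 v0 > 0"
    using assms(12) by (auto simp: E.inv_form_def Ns_def)
  have M0_ne: "M0 \<noteq> {}" and M1_ne: "M1 \<noteq> {}"
    using E.null_means_nonempty E.far_alternative[OF rank_X] by (auto simp: M0_def M1_def)
  have P_rej: "P (X *v (\<beta> + \<gamma>)) (\<sigma>2 *\<^sub>R \<Sigma>) (W C) = E.rej_prob (F \<Sigma>) ((1 / sqrt \<sigma>2) *\<^sub>R (R *v \<gamma>)) C"
    if "R *v \<beta> = r" "\<sigma>2 > 0" "\<Sigma> \<in> \<CC>" for \<beta> \<gamma> \<sigma>2 \<Sigma> C
    using E.rejection_probability[OF that(1,2) F(2)[OF that(3)], of \<gamma> C]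
    by (simp add: P_def W_def F(1)[OF that(3)])
  have P_M0: "P \<mu> (\<sigma>2 *\<^sub>R \<Sigma>) (W C) = E.rej_prob (F \<Sigma>) 0 C" if "\<mu> \<in> M0" "\<sigma>2 > 0" "\<Sigma> \<in> \<CC>" for \<mu> \<sigma>2 \<Sigma> C
    using that P_rej[of _ \<sigma>2 \<Sigma> 0 C] by (auto simp: M0_def null_means_def)
  have P_M1: "\<exists>w. P \<mu> (\<sigma>2 *\<^sub>R \<Sigma>) (W C) = E.rej_prob (F \<Sigma>) w C" if "\<mu> \<in> M1" "\<sigma>2 > 0" "\<Sigma> \<in> \<CC>" for \<mu> \<sigma>2 \<Sigma> C
  proof -
    have "\<mu> \<in> col_span X"
      using that(1) by (simp add: M1_def alt_means_def)
    then obtain \<beta> \<gamma> where "R *v \<beta> = r" "\<mu> = X *v (\<beta> + \<gamma>)"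
      by (rule E.mean_decomposition)
    then show ?thesis
      using P_rej that by blast
  qed
  \<comment> \<open>Hence means far from the null hypothesis have large shifts.\<close>
  obtain K where K: "K > 0"
    "\<And>\<beta> \<gamma>. R *v \<beta> = r \<Longrightarrow> infdist (X *v (\<beta> + \<gamma>)) M0 \<le> K * norm (R *v \<gamma>)"
    using E.infdist_null_means_le unfolding M0_def by blast
  have P_far: "\<exists>w. norm w \<ge> d / sqrt \<sigma>2 / K \<and> P \<mu> (\<sigma>2 *\<^sub>R \<Sigma>) (W C) = E.rej_prob (F \<Sigma>) w C"
    if "\<mu> \<in> M1" "\<sigma>2 > 0" "\<Sigma> \<in> \<CC>" "d \<le> infdist \<mu> M0" for \<mu> \<sigma>2 \<Sigma> C d
  proof -
    have "\<mu> \<in> col_span X"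
      using that(1) by (simp add: M1_def alt_means_def)
    then obtain \<beta> \<gamma> where \<beta>: "R *v \<beta> = r" and \<mu>: "\<mu> = X *v (\<beta> + \<gamma>)"
      by (rule E.mean_decomposition)
    have "d / K \<le> norm (R *v \<gamma>)"
      using K(2)[OF \<beta>, of \<gamma>] that(4) K(1) by (simp add: \<mu> divide_le_eq mult.commute)
    then have "d / K / sqrt \<sigma>2 \<le> norm (R *v \<gamma>) / sqrt \<sigma>2"
      using that(2) by (intro divide_right_mono) auto
    then have "d / sqrt \<sigma>2 / K \<le> norm ((1 / sqrt \<sigma>2) *\<^sub>R (R *v \<gamma>))"
      using that(2) by (simp add: field_simps)
    then show ?thesis
      using P_rej[OF \<beta> that(2,3), of \<gamma> C] \<mu> by blast
  qed
  have P_bounds: "0 \<le> P \<mu> (\<sigma>2 *\<^sub>R \<Sigma>) (W C)" for \<mu> \<sigma>2 \<Sigma> C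
    by (simp add: P_def)
  have rej_le_1: "E.rej_prob A w C \<le> 1" for A w C
    unfolding E.rej_prob_def by (rule prob_space.prob_le_1[OF prob_space_standard_gaussian])
  have pos_H: "AE y in lborel. y \<notin> E.Ns \<and> E.inv_form y v > 0"
    if "AE y in lborel. y \<notin> N \<longrightarrow> nonneg_definite (\<Omega> y)" "v \<noteq> 0" for v
    using E.AE_inv_form_pos[OF null_H that(1)] that(2) by blast
  have singular: "\<exists>\<psi> A' A0 t. E.renormalizes (\<lambda>m. F (S m)) \<psi> A' A0 t \<and> filterlim t at_top sequentially"
    if ab: ?a ?b and S: "\<And>m. S m \<in> \<CC>" "S \<longlonglongrightarrow> \<Sigma>'" "det \<Sigma>' = 0" for S \<Sigma>'
  proof -
    obtain \<phi> s D where "strict_mono (\<phi> :: nat \<Rightarrow> nat)" "\<And>i. 0 < s (\<phi> i)"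
      "(\<lambda>i. (1 / s (\<phi> i)) *\<^sub>R
                 (orth_proj_matrix (orthogonal_comp (col_span \<Sigma>')) ** S (\<phi> i) **
                  orth_proj_matrix (orthogonal_comp (col_span \<Sigma>')))) \<longlonglongrightarrow> D"
      "inj_on ((*v) D) (orthogonal_comp (col_span \<Sigma>'))"
      using ab(2) S by blast
    moreover have "T (y + z) = T y" if "z \<in> col_span \<Sigma>'" for y z
      using ab(1) that S by (auto simp: sing_limit_union_def)
    ultimately show ?thesis
      using E.renormalizes_singular[of "\<lambda>m. F (S m)" S \<Sigma>'] F(1) S unfolding T_def by blast
  qed
  have renormalizable: "E.renormalizable (F ` \<CC>)" if ab: ?a ?b
    unfolding E.renormalizable_def
  proof (intro allI impI)
    fix A :: "nat \<Rightarrow> real^'n^'n" assume "\<forall>m. A m \<in> F ` \<CC>"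
    then have "\<forall>m. \<exists>\<Sigma>. \<Sigma> \<in> \<CC> \<and> A m = F \<Sigma>"
      by blast
    then obtain S where S: "\<And>m. S m \<in> \<CC>" and "\<And>m. A m = F (S m)"
      by metis
    then have A: "A = (\<lambda>m. F (S m))"
      by auto
    have "bounded (range S)"
      using \<open>bounded \<CC>\<close> by (rule bounded_subset) (use S in auto)
    then obtain \<Sigma>' \<rho> where \<rho>: "strict_mono (\<rho> :: nat \<Rightarrow> nat)" and lim: "(\<lambda>i. S (\<rho> i)) \<longlonglongrightarrow> \<Sigma>'"
      using bounded_imp_convergent_subsequence[of S] by (auto simp: o_def)
    have "\<exists>\<psi> A' A0 t. E.renormalizes (A \<circ> \<rho>) \<psi> A' A0 t"
    proof (cases "det \<Sigma>' = 0")
      case True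
      then show ?thesis
        using singular[OF ab S lim] by (auto simp: A o_def)
    next
      case False
      then show ?thesis
        using E.renormalizes_regular[of "A \<circ> \<rho>", OF _ lim] S F(1) by (auto simp: A o_def)
    qed
    then show "\<exists>\<psi> A' A0 t. E.renormalizes A \<psi> A' A0 t"
      using E.renormalizes_subsequence \<rho> by blast
  qed
  have item1_sup: "(SUP \<mu>\<in>M0. SUP \<sigma>2\<in>{0<..}. SUP \<Sigma>\<in>\<CC>. P \<mu> (\<sigma>2 *\<^sub>R \<Sigma>) (W C)) < 1"
    if ab: ?a ?b and C: "C > 0" for C
  proof -
    obtain \<epsilon> where \<epsilon>: "\<epsilon> > 0" "\<And>\<Sigma>. \<Sigma> \<in> \<CC> \<Longrightarrow> E.rej_prob (F \<Sigma>) 0 C \<le> 1 - \<epsilon>"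
      using E.size_lt_1[OF renormalizable[OF ab] C] by auto
    have "(SUP \<mu>\<in>M0. SUP \<sigma>2\<in>{0<..}. SUP \<Sigma>\<in>\<CC>. P \<mu> (\<sigma>2 *\<^sub>R \<Sigma>) (W C)) \<le> 1 - \<epsilon>"
      by (intro cSUP3_le M0_ne CC) (auto simp: P_M0 \<epsilon>)
    with \<epsilon>(1) show ?thesis
      by linarith
  qed
  have item1_inf: "(INF \<mu>\<in>M0. INF \<sigma>2\<in>{0<..}. INF \<Sigma>\<in>\<CC>. P \<mu> (\<sigma>2 *\<^sub>R \<Sigma>) (W C)) > 0"
    if ab: ?a ?b for C
  proof -
    obtain \<epsilon> where \<epsilon>: "\<epsilon> > 0" "\<And>\<Sigma>. \<Sigma> \<in> \<CC> \<Longrightarrow> \<epsilon> \<le> E.rej_prob (F \<Sigma>) 0 C"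
      using E.rej_bounded_below[OF renormalizable[OF ab] v0, of "{0}" C] by auto
    have "\<epsilon> \<le> (INF \<mu>\<in>M0. INF \<sigma>2\<in>{0<..}. INF \<Sigma>\<in>\<CC>. P \<mu> (\<sigma>2 *\<^sub>R \<Sigma>) (W C))"
      by (intro cINF3_ge M0_ne CC) (auto simp: P_M0 \<epsilon>)
    with \<epsilon>(1) show ?thesis
      by linarith
  qed
  have item2: "(INF \<mu>\<in>M1. INF \<sigma>2\<in>{0<..}. INF \<Sigma>\<in>\<CC>. P \<mu> (\<sigma>2 *\<^sub>R \<Sigma>) (W C)) > 0"
    if ab: ?a ?b and dir: "\<forall>v. norm v = 1 \<longrightarrow>
          emeasure lborel {y. y \<notin> Ns \<and> v \<bullet> (matrix_inv (\<Omega> y) *v v) \<ge> 0} > 0" for C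
  proof -
    have "emeasure lborel {y. y \<notin> E.Ns \<and> E.inv_form y v > 0} \<noteq> 0" if v: "norm v = 1" for v
    proof (rule E.inv_form_pos_of_nonneg)
      show "emeasure lborel {y. y \<notin> E.Ns \<and> E.inv_form y v = 0} = 0"
        using v by (intro null_H) auto
      show "emeasure lborel {y. y \<notin> E.Ns \<and> E.inv_form y v \<ge> 0} > 0"
        using dir v by (simp add: E.inv_form_def Ns_def)
    qed
    then obtain \<epsilon> where \<epsilon>: "\<epsilon> > 0" "\<And>\<Sigma> w. \<Sigma> \<in> \<CC> \<Longrightarrow> \<epsilon> \<le> E.rej_prob (F \<Sigma>) w C"
      using E.rej_bounded_below[OF renormalizable[OF ab] v0, of UNIV C] by auto
    have "\<epsilon> \<le> (INF \<mu>\<in>M1. INF \<sigma>2\<in>{0<..}. INF \<Sigma>\<in>\<CC>. P \<mu> (\<sigma>2 *\<^sub>R \<Sigma>) (W C))"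
    proof (intro cINF3_ge M1_ne CC)
      fix \<mu> :: "real^'n" and \<sigma>2 :: real and \<Sigma> :: "real^'n^'n"
      assume "\<mu> \<in> M1" "\<sigma>2 \<in> {0<..}" "\<Sigma> \<in> \<CC>"
      then show "\<epsilon> \<le> P \<mu> (\<sigma>2 *\<^sub>R \<Sigma>) (W C)"
        using P_M1[of \<mu> \<sigma>2 \<Sigma> C] \<epsilon>(2) by auto
    qed simp
    with \<epsilon>(1) show ?thesis
      by linarith
  qed
  have item3_singular: "(\<lambda>m. INF (\<mu>, \<sigma>2) \<in> {(\<mu>, \<sigma>2). \<mu> \<in> M1 \<and> 0 < \<sigma>2 \<and> infdist \<mu> M0 / sqrt \<sigma>2 \<ge> c}.
                 P \<mu> (\<sigma>2 *\<^sub>R S m) (W C)) \<longlonglongrightarrow> 1"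
    if ab: ?a ?b and nonneg: "AE y in lborel. y \<notin> N \<longrightarrow> nonneg_definite (\<Omega> y)"
      and c: "c > 0" and S: "\<And>m. S m \<in> \<CC>" "S \<longlonglongrightarrow> \<Sigma>'" "det \<Sigma>' = 0" for C c S \<Sigma>'
  proof -
    let ?I = "{(\<mu>, \<sigma>2). \<mu> \<in> M1 \<and> 0 < \<sigma>2 \<and> infdist \<mu> M0 / sqrt \<sigma>2 \<ge> c}"
    have I_far: "\<exists>w. norm w \<ge> c / K \<and> P \<mu> (\<sigma>2 *\<^sub>R S m) (W C) = E.rej_prob (F (S m)) w C"
      if "(\<mu>, \<sigma>2) \<in> ?I" for \<mu> \<sigma>2 m
    proof -
      have "c * sqrt \<sigma>2 \<le> infdist \<mu> M0"
        using that by (simp add: le_divide_eq)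
      then show ?thesis
        using P_far[of \<mu> \<sigma>2 "S m" "c * sqrt \<sigma>2" C] that S(1) by auto
    qed
    have ev: "\<forall>\<^sub>F m in sequentially. \<forall>w. norm w \<ge> c / K \<longrightarrow> E.rej_prob (F (S m)) w C \<ge> 1 - \<epsilon>" if "\<epsilon> > 0" for \<epsilon>
    proof (rule E.rej_tendsto_1[OF pos_H[OF nonneg] _ that])
      fix \<rho> :: "nat \<Rightarrow> nat" assume \<rho>: "strict_mono \<rho>"
      have "(\<lambda>i. S (\<rho> i)) \<longlonglongrightarrow> \<Sigma>'"
        using LIMSEQ_subseq_LIMSEQ[OF S(2) \<rho>] by (simp add: o_def)
      then obtain \<psi> A' A0 t where "E.renormalizes ((\<lambda>m. F (S m)) \<circ> \<rho>) \<psi> A' A0 t"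
        and t: "filterlim t at_top sequentially"
        using singular[OF ab, of "\<lambda>i. S (\<rho> i)" \<Sigma>'] S(1,3) unfolding o_def by blast
      moreover have "filterlim (\<lambda>i. t i * (c / K)) at_top sequentially"
        using filterlim_at_top_mult_tendsto_pos[OF tendsto_const _ t, of "c / K"] c K(1) by simp
      ultimately show "\<exists>\<psi> A' A0 t. E.renormalizes ((\<lambda>m. F (S m)) \<circ> \<rho>) \<psi> A' A0 t
          \<and> filterlim (\<lambda>i. t i * (c / K)) at_top sequentially"
        by blast
    qed
    show ?thesis
    proof (rule tendsto_INF_1)
      obtain \<mu> where "\<mu> \<in> M1" "infdist \<mu> M0 \<ge> c"
        using E.far_alternative[OF rank_X] by (auto simp: M0_def M1_def)
      then have "(\<mu>, 1) \<in> ?I"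
        by simp
      then show "?I \<noteq> {}"
        by blast
      show "(case x of (\<mu>, \<sigma>2) \<Rightarrow> P \<mu> (\<sigma>2 *\<^sub>R S m) (W C)) \<le> 1" if "x \<in> ?I" for x m
      proof (cases x)
        case (Pair \<mu> \<sigma>2)
        then show ?thesis
          using I_far[of \<mu> \<sigma>2 m] that rej_le_1 by auto
      qed
      show "\<forall>\<^sub>F m in sequentially. \<forall>x\<in>?I. 1 - \<epsilon> \<le> (case x of (\<mu>, \<sigma>2) \<Rightarrow> P \<mu> (\<sigma>2 *\<^sub>R S m) (W C))"
        if "\<epsilon> > 0" for \<epsilon>
        using ev[OF that]
      proof eventually_elim
        case (elim m)
        show ?case
        proof (intro ballI)
          fix x assume "x \<in> ?I"
          then show "1 - \<epsilon> \<le> (case x of (\<mu>, \<sigma>2) \<Rightarrow> P \<mu> (\<sigma>2 *\<^sub>R S m) (W C))"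
          proof (cases x)
            case (Pair \<mu> \<sigma>2)
            then show ?thesis
              using I_far[of \<mu> \<sigma>2 m] \<open>x \<in> ?I\<close> elim by auto
          qed
        qed
      qed
    qed (auto simp: P_bounds split: prod.split)
  qed
  have item3_regular: "(\<lambda>m. INF \<mu> \<in> {\<mu>. \<mu> \<in> M1 \<and> infdist \<mu> M0 \<ge> c m}.
                P \<mu> (\<sigma>2 m *\<^sub>R S m) (W C)) \<longlonglongrightarrow> 1"
    if nonneg: "AE y in lborel. y \<notin> N \<longrightarrow> nonneg_definite (\<Omega> y)"
      and \<sigma>2: "\<And>m. 0 < \<sigma>2 m" and c: "filterlim (\<lambda>m. c m / sqrt (\<sigma>2 m)) at_top sequentially"
      and S: "\<And>m. S m \<in> \<CC>" "S \<longlonglongrightarrow> \<Sigma>'" "det \<Sigma>' \<noteq> 0" for C c \<sigma>2 S \<Sigma>'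
  proof -
    let ?I = "\<lambda>m. {\<mu>. \<mu> \<in> M1 \<and> infdist \<mu> M0 \<ge> c m}"
    have I_far: "\<exists>w. norm w \<ge> c m / sqrt (\<sigma>2 m) / K \<and> P \<mu> (\<sigma>2 m *\<^sub>R S m) (W C) = E.rej_prob (F (S m)) w C"
      if "\<mu> \<in> ?I m" for \<mu> m
      using P_far[of \<mu> "\<sigma>2 m" "S m" "c m" C] that S(1) \<sigma>2 by auto
    have l: "filterlim (\<lambda>m. c m / sqrt (\<sigma>2 m) / K) at_top sequentially"
      using filterlim_at_top_mult_tendsto_pos[OF tendsto_const _ c, of "1 / K"] K(1) by simp
    have ev: "\<forall>\<^sub>F m in sequentially. \<forall>w. norm w \<ge> c m / sqrt (\<sigma>2 m) / K \<longrightarrow> E.rej_prob (F (S m)) w C \<ge> 1 - \<epsilon>"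
      if "\<epsilon> > 0" for \<epsilon>
    proof (rule E.rej_tendsto_1[OF pos_H[OF nonneg] _ that])
      fix \<rho> :: "nat \<Rightarrow> nat" assume \<rho>: "strict_mono \<rho>"
      have "(\<lambda>i. S (\<rho> i)) \<longlonglongrightarrow> \<Sigma>'"
        using LIMSEQ_subseq_LIMSEQ[OF S(2) \<rho>] by (simp add: o_def)
      then obtain \<psi> A' A0 where ren: "E.renormalizes ((\<lambda>m. F (S m)) \<circ> \<rho>) \<psi> A' A0 (\<lambda>_. 1)"
        using E.renormalizes_regular[of "(\<lambda>m. F (S m)) \<circ> \<rho>" "\<lambda>i. S (\<rho> i)" \<Sigma>'] S F(1) by auto
      then have "strict_mono \<psi>"
        by (simp add: E.renormalizes_def)
      then have "filterlim (\<lambda>i. 1 * (c (\<rho> (\<psi> i)) / sqrt (\<sigma>2 (\<rho> (\<psi> i))) / K)) at_top sequentially"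
        using filterlim_compose[OF l filterlim_subseq[OF strict_mono_o[OF \<rho>]]] by simp
      with ren show "\<exists>\<psi> A' A0 t. E.renormalizes ((\<lambda>m. F (S m)) \<circ> \<rho>) \<psi> A' A0 t
          \<and> filterlim (\<lambda>i. t i * (c (\<rho> (\<psi> i)) / sqrt (\<sigma>2 (\<rho> (\<psi> i))) / K)) at_top sequentially"
        by blast
    qed
    show ?thesis
    proof (rule tendsto_INF_1)
      show "?I m \<noteq> {}" for m
        using E.far_alternative[OF rank_X, of "c m"] by (auto simp: M0_def M1_def)
      show "P \<mu> (\<sigma>2 m *\<^sub>R S m) (W C) \<le> 1" if "\<mu> \<in> ?I m" for \<mu> m
        using I_far[OF that] rej_le_1 by auto
      show "\<forall>\<^sub>F m in sequentially. \<forall>\<mu>\<in>?I m. 1 - \<epsilon> \<le> P \<mu> (\<sigma>2 m *\<^sub>R S m) (W C)" if "\<epsilon> > 0" for \<epsilon>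
        using ev[OF that]
      proof eventually_elim
        case (elim m)
        show ?case
        proof
          fix \<mu> assume "\<mu> \<in> ?I m"
          then show "1 - \<epsilon> \<le> P \<mu> (\<sigma>2 m *\<^sub>R S m) (W C)"
            using I_far[of \<mu> m] elim by auto
        qed
      qed
    qed (auto simp: P_bounds)
  qed
  have item4: "\<exists>C>0. (SUP \<mu>\<in>M0. SUP \<sigma>2\<in>{0<..}. SUP \<Sigma>\<in>\<CC>. P \<mu> (\<sigma>2 *\<^sub>R \<Sigma>) (W C)) \<le> \<delta>"
    if ab: ?a ?b and \<delta>: "\<delta> > 0" for \<delta>
  proof -
    obtain C where C: "C > 0" "\<And>\<Sigma>. \<Sigma> \<in> \<CC> \<Longrightarrow> E.rej_prob (F \<Sigma>) 0 C \<le> \<delta>"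
      using E.size_tight[OF renormalizable[OF ab] \<delta>] by auto
    have "(SUP \<mu>\<in>M0. SUP \<sigma>2\<in>{0<..}. SUP \<Sigma>\<in>\<CC>. P \<mu> (\<sigma>2 *\<^sub>R \<Sigma>) (W C)) \<le> \<delta>"
      by (intro cSUP3_le M0_ne CC) (auto simp: P_M0 C)
    with C(1) show ?thesis
      by blast
  qed
  have pos_det: "det \<Sigma>' \<noteq> 0" if "pos_definite \<Sigma>'" for \<Sigma>' :: "real^'n^'n"
    using pos_definite_factorization[OF that] by (metis det_mul det_transpose mult_eq_0_iff)
  show ?thesis
    apply (intro conjI impI)
    subgoal premises ab
      using item1_sup[OF conjunct1[OF ab] conjunct2[OF ab]] item1_inf[OF conjunct1[OF ab] conjunct2[OF ab]]
      by blast
    subgoal premises ab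
      using item2[OF conjunct1[OF ab(1)] conjunct2[OF ab(1)] ab(2)] by blast
    subgoal premises ab
      using item3_singular[OF conjunct1[OF ab(1)] conjunct2[OF ab(1)] ab(2)] by blast
    subgoal premises ab
      using item4[OF conjunct1[OF ab] conjunct2[OF ab]] by blast
    subgoal premises nonneg
      using item3_regular[OF nonneg] pos_det by blast
    done
qed

end
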